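(* Let $\mathbf{k}$ be a field of characteristic $0$, $m$ a positive integer, and for $i=1,\dots,m$ let $X_i \subseteq V_i$ be a conical subscheme of a finite-dimensional vector space $V_i$. For every positive integer $r$ there is an integer $C_{\mathbf{X}}(r)$, depending on $r$ and the $X_i$ but independent of $\mathbf{d}$, such that for every $m$-tuple of positive integers $\mathbf{d}=(d_1,\dots,d_m)$ the ideal of $\mathrm{Sec}_{\mathbf{d},r}(\mathbf{X})$ is generated by polynomials of degree $\le C_{\mathbf{X}}(r)$.
   Context: A subscheme $X_i\subseteq V_i$ is conical if its ideal $I_{X_i}\subseteq \mathrm{Sym}(V_i^* )$ is homogeneous; set $B^{(i)} = \mathrm{Sym}(V_i^* )/I_{X_i}$ and let $R = B^{(1)}\otimes\cdots\otimes B^{(m)}$ with its $\mathbf{Z}_{\ge0}^m$-grading, $R_{\mathbf{d}} = B^{(1)}_{d_1}\otimes\cdots\otimes B^{(m)}_{d_m}$. For a vector space $W$ and ideals $I,J\subseteq\mathrm{Sym}(W)$, the join $I\star J$ is the kernel of $\mathrm{Sym}(W)\xrightarrow{\Delta}\mathrm{Sym}(W)\otimes\mathrm{Sym}(W)\to \mathrm{Sym}(W)/I\otimes\mathrm{Sym}(W)/J$, where $\Delta$ is the algebra homomorphism with $\Delta(w)=w\otimes1+1\otimes w$ for $w\in W$; $I^{\star1}=I$, $I^{\star r}=I\star I^{\star(r-1)}$. Let $J_{\mathbf{d}}\subseteq\mathrm{Sym}(R_{\mathbf{d}})$ be the kernel of the multiplication map $\mathrm{Sym}(R_{\mathbf{d}})\to\bigoplus_{e\ge0}R_{e\mathbf{d}}$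 (the ideal of the Segre--Veronese embedding of $X_1\times\cdots\times X_m$ given by $\mathbf{d}$). $\mathrm{Sec}_{\mathbf{d},r}(\mathbf{X})$ is the subscheme of $R_{\mathbf{d}}^*\subseteq \mathrm{D}^{d_1}V_1\otimes\cdots\otimes\mathrm{D}^{d_m}V_m$ defined by $J_{\mathbf{d}}^{\star r}$; for varieties over an algebraically closed field it is the Zariski closure of the set of sums $\sum_{i=1}^r x_{1,i}^{\otimes d_1}\otimes\cdots\otimes x_{m,i}^{\otimes d_m}$ with $x_{j,i}\in X_j$. *)

theory Defs
  imports "HOL-Library.Poly_Mapping"
begin

(* Polynomials over a field in variables of type 'v are modelled as finitely supported
maps from monomials ('v <Rightarrow><^sub>0 nat) to coefficients; Poly_Mapping supplies the
commutative ring structure (convolution product). *)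

type_synonym ('v, 'k) mpoly = "('v \<Rightarrow>\<^sub>0 nat) \<Rightarrow>\<^sub>0 'k"

definition mvar :: "'v \<Rightarrow> ('v, 'k::comm_ring_1) mpoly" where
  "mvar v = Poly_Mapping.single (Poly_Mapping.single v 1) 1"

definition mconst :: "'k::comm_ring_1 \<Rightarrow> ('v, 'k) mpoly" where
  "mconst c = Poly_Mapping.single 0 c"

definition mon_deg :: "('v \<Rightarrow>\<^sub>0 nat) \<Rightarrow> nat" where
  "mon_deg mon = (\<Sum>v\<in>Poly_Mapping.keys mon. Poly_Mapping.lookup mon v)"

definition total_deg :: "('v, 'k::zero) mpoly \<Rightarrow> nat" where
  "total_deg p = Max (insert 0 (mon_deg ` Poly_Mapping.keys p))"

(* Polynomials involving only variables from a set Vs (the polynomial ring Sym(W^dual) for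
W with coordinate set Vs). *)
definition poly_in :: "'v set \<Rightarrow> ('v, 'k::zero) mpoly set" where
  "poly_in Vs = {p. \<forall>mon\<in>Poly_Mapping.keys p. Poly_Mapping.keys mon \<subseteq> Vs}"

definition hom_part :: "nat \<Rightarrow> ('v, 'k::zero) mpoly \<Rightarrow> ('v, 'k) mpoly" where
  "hom_part e p = Abs_poly_mapping (\<lambda>mon. if mon_deg mon = e then Poly_Mapping.lookup p mon else 0)"

definition is_ideal_in :: "'v set \<Rightarrow> ('v, 'k::comm_ring_1) mpoly set \<Rightarrow> bool" where
  "is_ideal_in Vs I \<longleftrightarrow> I \<subseteq> poly_in Vs \<and> 0 \<in> I \<and> (\<forall>f\<in>I. \<forall>g\<in>I. f + g \<in> I)
      \<and> (\<forall>f\<in>I. \<forall>g\<in>poly_in Vs. g * f \<in> I)"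

definition homogeneous_ideal :: "'v set \<Rightarrow> ('v, 'k::comm_ring_1) mpoly set \<Rightarrow> bool" where
  "homogeneous_ideal Vs I \<longleftrightarrow> is_ideal_in Vs I \<and> (\<forall>f\<in>I. \<forall>e. hom_part e f \<in> I)"

(* Ideal generated by a set (in the polynomial ring over all variables of the type). *)
definition ideal_gen :: "('v, 'k::comm_ring_1) mpoly set \<Rightarrow> ('v, 'k) mpoly set" where
  "ideal_gen G = {f. \<exists>F a. finite F \<and> F \<subseteq> G \<and> f = (\<Sum>g\<in>F. a g * g)}"

definition poly_subst :: "('v \<Rightarrow> ('w, 'k::comm_ring_1) mpoly) \<Rightarrow> ('v, 'k) mpoly \<Rightarrow> ('w, 'k) mpoly" where
  "poly_subst \<sigma> p = (\<Sum>mon\<in>Poly_Mapping.keys p. mconst (Poly_Mapping.lookup p mon) * (\<Prod>v\<in>Poly_Mapping.keys mon. \<sigma> v ^ Poly_Mapping.lookup mon v))"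

(* Join of ideals I, J of Sym(W) (W with coordinates Vs): the kernel of
Sym(W) <rightarrow> Sym(W) <otimes> Sym(W) <rightarrow> Sym(W)/I <otimes> Sym(W)/J, where Sym(W)<otimes>Sym(W) is the polynomial
ring in two copies (v,False), (v,True) of the variables, the quotient being by the ideal
generated by the two copies of I and J, and <Delta>(v) = v<otimes>1 + 1<otimes>v. *)
definition join_ideal :: "'v set \<Rightarrow> ('v, 'k::comm_ring_1) mpoly set \<Rightarrow> ('v, 'k) mpoly set \<Rightarrow> ('v, 'k) mpoly set" where
  "join_ideal Vs I J = {f \<in> poly_in Vs.
      poly_subst (\<lambda>v. mvar (v, False) + mvar (v, True)) f
        \<in> ideal_gen (poly_subst (\<lambda>v. mvar (v, False)) ` I \<union> poly_subst (\<lambda>v. mvar (v, True)) ` J)}"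

(* I^{<star>1} = I, I^{<star>r} = I <star> I^{<star>(r-1)} (the value at r = 0 is irrelevant). *)
fun join_pow :: "'v set \<Rightarrow> ('v, 'k::comm_ring_1) mpoly set \<Rightarrow> nat \<Rightarrow> ('v, 'k) mpoly set" where
  "join_pow Vs I 0 = I"
| "join_pow Vs I (Suc 0) = I"
| "join_pow Vs I (Suc (Suc r)) = join_ideal Vs I (join_pow Vs I (Suc r))"

(* Coordinates: V_i has coordinates x_{i,j}, j < n i (i < m); in the combined polynomial
ring the variable x_{i,j} is (i,j). A monomial <mu> in the combined variables of multidegree d
indexes the monomial basis of Sym^{d_1}(V_1^dual) <otimes> ... <otimes> Sym^{d_m}(V_m^dual), i.e. the coordinates
of D^{d_1}V_1 <otimes> ... <otimes> D^{d_m}V_m. *)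
definition sv_mons :: "nat \<Rightarrow> (nat \<Rightarrow> nat) \<Rightarrow> (nat \<Rightarrow> nat) \<Rightarrow> ((nat \<times> nat) \<Rightarrow>\<^sub>0 nat) set" where
  "sv_mons m n d = {\<mu>. Poly_Mapping.keys \<mu> \<subseteq> {(i, j). i < m \<and> j < n i}
                        \<and> (\<forall>i<m. (\<Sum>j<n i. Poly_Mapping.lookup \<mu> (i, j)) = d i)}"

(* The ideal of X_1 <times> ... <times> X_m in the combined ring (so that the combined ring modulo it is
B^{(1)} <otimes> ... <otimes> B^{(m)}). *)
definition prod_ideal :: "nat \<Rightarrow> (nat \<Rightarrow> nat) \<Rightarrow> (nat \<Rightarrow> (nat, 'k::comm_ring_1) mpoly set) \<Rightarrow> (nat \<times> nat, 'k) mpoly set" where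
  "prod_ideal m n I = ideal_gen (\<Union>i<m. poly_subst (\<lambda>j. mvar (i, j)) ` I i)"

(* Segre--Veronese ideal J_d (in the coordinate ring of D^{d_1}V_1 <otimes> ... <otimes> D^{d_m}V_m):
kernel of z_<mu> <mapsto> <mu> into B^{(1)} <otimes> ... <otimes> B^{(m)}. *)
definition sv_ideal :: "nat \<Rightarrow> (nat \<Rightarrow> nat) \<Rightarrow> (nat \<Rightarrow> (nat, 'k::comm_ring_1) mpoly set) \<Rightarrow> (nat \<Rightarrow> nat)
    \<Rightarrow> ((nat \<times> nat) \<Rightarrow>\<^sub>0 nat, 'k) mpoly set" where
  "sv_ideal m n I d = {f \<in> poly_in (sv_mons m n d).
      poly_subst (\<lambda>\<mu>. Poly_Mapping.single \<mu> 1) f \<in> prod_ideal m n I}"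

definition sec_ideal :: "nat \<Rightarrow> (nat \<Rightarrow> nat) \<Rightarrow> (nat \<Rightarrow> (nat, 'k::comm_ring_1) mpoly set) \<Rightarrow> (nat \<Rightarrow> nat) \<Rightarrow> nat
    \<Rightarrow> ((nat \<times> nat) \<Rightarrow>\<^sub>0 nat, 'k) mpoly set" where
  "sec_ideal m n I d r = join_pow (sv_mons m n d) (sv_ideal m n I d) r"

definition generated_in_degree_le :: "'v set \<Rightarrow> ('v, 'k::comm_ring_1) mpoly set \<Rightarrow> nat \<Rightarrow> bool" where
  "generated_in_degree_le Vs K C \<longleftrightarrow>
     (\<exists>G. G \<subseteq> poly_in Vs \<and> (\<forall>g\<in>G. total_deg g \<le> C) \<and> K = poly_in Vs \<inter> ideal_gen G)"

end

theory Submission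
  imports Defs Complex_Main "HOL-Library.Sublist" "HOL-Library.Ramsey" "HOL-Library.List_Lexorder"
    "HOL-Library.Product_Lexorder" "HOL-Combinatorics.Permutations"
begin

text \<open>
  A form of degree \<open>e\<close> on the space of the Segre--Veronese embedding given by \<open>d\<close> is, in characteristic
  \<open>0\<close>, a symmetric polynomial \<open>F\<close> in \<open>e\<close> groups of variables that has multidegree \<open>d\<close> in each group.
  Separating multidegrees, it vanishes on the \<open>r\<close>-th secant scheme iff for every colouring of the \<open>e\<close>
  groups by \<open>r\<close> colours, identifying the groups of equal colour turns \<open>F\<close> into an element of the ideal of
  \<open>X\<^sup>r\<close>. This condition no longer mentions \<open>d\<close>, makes sense for nonsymmetric \<open>F\<close>, and is preserved by
  multiplication with words of monomials (which changes \<open>d\<close>) and by insertion of a new group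
  (which changes \<open>e\<close>). Both operations respect the lexicographic order on words of monomials, so by the
  lemmas of Dickson and Higman finitely many leading words generate all leading words for all \<open>d\<close> and
  \<open>e\<close> at once. If \<open>e\<close> exceeds the lengths of these words, then every leading word arises by an
  insertion, hence \<open>F\<close> is a sum of insertions, and insertions symmetrize to multiples of forms of degree
  \<open>e - 1\<close> in the ideal.
\<close>

subsection \<open>Linear extension of maps on monomials\<close>

abbreviation "lookup \<equiv> Poly_Mapping.lookup"
abbreviation "keys \<equiv> Poly_Mapping.keys"
abbreviation "single \<equiv> Poly_Mapping.single"

text \<open>Scalars act over an arbitrary index type, since the same operation is needed for linear
  combinations of words as for polynomials.\<close>

definition smul :: "'k::comm_ring_1 \<Rightarrow> ('a \<Rightarrow>\<^sub>0 'k) \<Rightarrow> ('a \<Rightarrow>\<^sub>0 'k)" where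
  "smul c p = Poly_Mapping.map ((*) c) p"

lemma lookup_smul [simp]: "lookup (smul c p) t = c * lookup p t"
  by (simp add: smul_def Poly_Mapping.map.rep_eq when_def)

lemma smul_simps [simp]:
  "smul 0 p = 0" "smul 1 p = p" "smul c 0 = 0" "smul c (smul d p) = smul (c * d) p"
  "smul c (single t d) = single t (c * d)"
  by (rule poly_mapping_eqI; simp add: lookup_single when_def mult.assoc)+

lemma smul_add: "smul c (p + q) = smul c p + smul c q"
  and smul_add_left: "smul (c + d) p = smul c p + smul d p"
  and smul_minus_left: "smul (- c) p = - smul c p"
  by (rule poly_mapping_eqI; simp add: lookup_add lookup_minus algebra_simps)+

lemma smul_sum: "smul c (\<Sum>i\<in>A. f i) = (\<Sum>i\<in>A. smul c (f i))"
  by (rule poly_mapping_eqI) (simp add: lookup_sum sum_distrib_left)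

lemma smul_sum_left: "smul (\<Sum>i\<in>A. f i) p = (\<Sum>i\<in>A. smul (f i) p)"
  by (rule poly_mapping_eqI) (simp add: lookup_sum sum_distrib_right)

lemma mconst_mult: "mconst c * p = smul c p"
  by (simp add: mconst_def smul_def mult_map_scale_conv_mult)

lemma smul_mult_left: "smul c p * q = smul c (p * q)" for p :: "('v, 'k::comm_ring_1) mpoly"
  by (simp flip: mconst_mult add: mult.assoc)

lemma smul_mult_right: "p * smul c q = smul c (p * q)" for p :: "('v, 'k::comm_ring_1) mpoly"
  by (simp flip: mconst_mult add: mult.left_commute)

lemma sum_single_lookup: "(\<Sum>t\<in>keys p. single t (lookup p t)) = (p :: 'a \<Rightarrow>\<^sub>0 'b::comm_monoid_add)"
proof (rule poly_mapping_eqI)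
  fix s
  have "lookup (\<Sum>t\<in>keys p. single t (lookup p t)) s = (\<Sum>t\<in>keys p. if t = s then lookup p t else 0)"
    unfolding lookup_sum by (rule sum.cong) (auto simp: lookup_single when_def)
  also have "\<dots> = lookup p s"
    by (simp add: not_in_keys_iff_lookup_eq_zero)
  finally show "lookup (\<Sum>t\<in>keys p. single t (lookup p t)) s = lookup p s" .
qed

text \<open>The linear extension of \<open>g\<close> from basis elements. Substitution, projection
  to graded pieces, evaluation and symmetrization are all instances, so identities between their
  composites reduce to basis elements by \<open>lin_lin\<close> and \<open>lin_cong\<close>.\<close>

definition lin :: "('a \<Rightarrow> 'b \<Rightarrow>\<^sub>0 'k) \<Rightarrow> ('a \<Rightarrow>\<^sub>0 'k::comm_ring_1) \<Rightarrow> ('b \<Rightarrow>\<^sub>0 'k)" where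
  "lin g p = (\<Sum>t\<in>keys p. smul (lookup p t) (g t))"

lemma lin_superset:
  assumes "finite A" "keys p \<subseteq> A"
  shows "lin g p = (\<Sum>t\<in>A. smul (lookup p t) (g t))"
  unfolding lin_def using assms
  by (intro sum.mono_neutral_left) (auto simp: in_keys_iff)

lemma lin_0 [simp]: "lin g 0 = 0"
  by (simp add: lin_def)

lemma lin_single [simp]: "lin g (single t c) = smul c (g t)"
  by (simp add: lin_def)

lemma lin_add: "lin g (p + q) = lin g p + lin g q"
proof -
  let ?A = "keys p \<union> keys q"
  have "keys (p + q) \<subseteq> ?A" by (rule keys_add)
  then show ?thesis
    by (simp add: lin_superset[of ?A] lookup_add smul_add_left sum.distrib)
qed

lemma lin_smul: "lin g (smul c p) = smul c (lin g p)"
proof -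
  have "keys (smul c p) \<subseteq> keys p" by (auto simp: in_keys_iff)
  then show ?thesis
    by (simp add: lin_superset[of "keys p"] smul_sum)
qed

lemma lin_minus: "lin g (- p) = - lin g p"
  using lin_smul[of g "-1" p] by (simp add: smul_minus_left)

lemma lin_diff: "lin g (p - q) = lin g p - lin g q"
  using lin_add[of g p "- q"] by (simp add: lin_minus)

lemma lin_sum: "lin g (\<Sum>i\<in>A. f i) = (\<Sum>i\<in>A. lin g (f i))"
  by (induction A rule: infinite_finite_induct) (auto simp: lin_add)

lemma lin_cong: "(\<And>t. t \<in> keys p \<Longrightarrow> g t = h t) \<Longrightarrow> lin g p = lin h p"
  by (simp add: lin_def)

lemma lin_lin: "lin h (lin g p) = lin (\<lambda>t. lin h (g t)) p"
  by (simp add: lin_def[of g] lin_def[of "\<lambda>t. lin h (g t)"] lin_sum lin_smul)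

lemma lin_id [simp]: "lin (\<lambda>t. single t 1) p = p"
  by (simp add: lin_def sum_single_lookup)

lemma lin_sum_fun: "lin (\<lambda>t. \<Sum>i\<in>A. g i t) p = (\<Sum>i\<in>A. lin (g i) p)"
  unfolding lin_def smul_sum by (rule sum.swap)

lemma lin_mult_right: "q * lin g p = lin (\<lambda>t. q * g t) p" for q :: "('v, 'k::comm_ring_1) mpoly"
  unfolding lin_def by (simp add: sum_distrib_left smul_mult_right)

lemma keys_lin:
  fixes g :: "'c \<Rightarrow> 'a \<Rightarrow>\<^sub>0 'b::comm_ring_1"
  shows "keys (lin g p) \<subseteq> (\<Union>t\<in>keys p. keys (g t))"
proof -
  have "keys (lin g p) \<subseteq> (\<Union>t\<in>keys p. keys (smul (lookup p t) (g t)))"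
    unfolding lin_def by (rule keys_sum)
  also have "\<dots> \<subseteq> (\<Union>t\<in>keys p. keys (g t))"
    by (intro UN_mono) (auto simp: in_keys_iff)
  finally show ?thesis .
qed

text \<open>Serves both for polynomials, built from terms, and for monomials, built from powers of
  variables. The set \<open>K\<close> keeps track of the allowed support.\<close>

lemma poly_mapping_single_induct [case_names zero add]:
  assumes "P 0" "\<And>p t c. P p \<Longrightarrow> t \<in> K \<Longrightarrow> P (p + single t c)" "keys p \<subseteq> K"
  shows "P (p :: 'a \<Rightarrow>\<^sub>0 'b::comm_monoid_add)"
proof -
  have "P (\<Sum>t\<in>A. single t (lookup p t))" if "finite A" "A \<subseteq> K" for A
    using that
  proof (induction A rule: finite_induct)
    case (insert t A)
    then show ?case
      using assms(2)[of "\<Sum>t\<in>A. single t (lookup p t)" t "lookup p t"] by (simp add: add.commute)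
  qed (simp add: assms(1))
  from this[of "keys p"] show ?thesis using assms(3) by (simp add: sum_single_lookup)
qed

subsection \<open>Substitution homomorphisms\<close>

definition subst_mon :: "('v \<Rightarrow> 'a::comm_monoid_mult) \<Rightarrow> ('v \<Rightarrow>\<^sub>0 nat) \<Rightarrow> 'a" where
  "subst_mon \<sigma> t = (\<Prod>v\<in>keys t. \<sigma> v ^ lookup t v)"

lemma subst_mon_superset:
  assumes "finite A" "keys t \<subseteq> A"
  shows "subst_mon \<sigma> t = (\<Prod>v\<in>A. \<sigma> v ^ lookup t v)"
  unfolding subst_mon_def using assms
  by (intro prod.mono_neutral_left) (auto simp: in_keys_iff)

lemma subst_mon_0 [simp]: "subst_mon \<sigma> 0 = 1"
  by (simp add: subst_mon_def)

lemma subst_mon_single [simp]: "subst_mon \<sigma> (single v n) = \<sigma> v ^ n"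
  by (simp add: subst_mon_def)

lemma subst_mon_add: "subst_mon \<sigma> (s + t) = subst_mon \<sigma> s * subst_mon \<sigma> t"
proof -
  let ?A = "keys s \<union> keys t"
  have "keys (s + t) \<subseteq> ?A" by (rule keys_add)
  then show ?thesis
    by (simp add: subst_mon_superset[of ?A] lookup_add power_add prod.distrib)
qed

lemma poly_subst_lin: "poly_subst \<sigma> p = lin (subst_mon \<sigma>) p"
  by (simp add: poly_subst_def lin_def mconst_mult subst_mon_def)

lemma poly_subst_0 [simp]: "poly_subst \<sigma> 0 = 0"
  and poly_subst_single: "poly_subst \<sigma> (single t c) = smul c (subst_mon \<sigma> t)"
  and poly_subst_add: "poly_subst \<sigma> (p + q) = poly_subst \<sigma> p + poly_subst \<sigma> q"
  and poly_subst_diff: "poly_subst \<sigma> (p - q) = poly_subst \<sigma> p - poly_subst \<sigma> q"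
  and poly_subst_smul: "poly_subst \<sigma> (smul c p) = smul c (poly_subst \<sigma> p)"
  and poly_subst_sum: "poly_subst \<sigma> (\<Sum>i\<in>A. f i) = (\<Sum>i\<in>A. poly_subst \<sigma> (f i))"
  by (simp_all add: poly_subst_lin lin_add lin_diff lin_smul lin_sum)

lemma poly_subst_mvar [simp]: "poly_subst \<sigma> (mvar v) = \<sigma> v"
  by (simp add: mvar_def poly_subst_single)

lemma poly_subst_1 [simp]: "poly_subst \<sigma> 1 = 1"
  using poly_subst_single[of \<sigma> 0 1] by simp

lemma poly_subst_mult: "poly_subst \<sigma> (p * q) = poly_subst \<sigma> p * poly_subst \<sigma> q"
proof (rule poly_mapping_single_induct[of _ UNIV p])
  fix p t c assume *: "poly_subst \<sigma> (p * q) = poly_subst \<sigma> p * poly_subst \<sigma> q"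
  have "poly_subst \<sigma> (single t c * q) = poly_subst \<sigma> (single t c) * poly_subst \<sigma> q"
    by (rule poly_mapping_single_induct[of _ UNIV q])
      (auto simp: distrib_left poly_subst_add mult_single subst_mon_add
        smul_mult_left smul_mult_right mult.commute poly_subst_single)
  with * show "poly_subst \<sigma> ((p + single t c) * q) = poly_subst \<sigma> (p + single t c) * poly_subst \<sigma> q"
    by (simp add: distrib_right poly_subst_add)
qed auto

lemma poly_subst_prod: "poly_subst \<sigma> (\<Prod>i\<in>A. f i) = (\<Prod>i\<in>A. poly_subst \<sigma> (f i))"
  by (induction A rule: infinite_finite_induct) (auto simp: poly_subst_mult)

lemma poly_subst_power: "poly_subst \<sigma> (p ^ n) = poly_subst \<sigma> p ^ n"
  by (induction n) (auto simp: poly_subst_mult)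

lemma poly_subst_poly_subst:
  "poly_subst \<tau> (poly_subst \<sigma> p) = poly_subst (\<lambda>v. poly_subst \<tau> (\<sigma> v)) p"
  unfolding poly_subst_lin[of \<sigma>] poly_subst_lin[of "\<lambda>v. poly_subst \<tau> (\<sigma> v)"]
  unfolding poly_subst_lin[of \<tau> "lin _ _"] lin_lin
  by (rule lin_cong) (simp flip: poly_subst_lin add: subst_mon_def poly_subst_prod poly_subst_power)

section \<open>Renaming of variables\<close>

lemma mvar_power: "mvar v ^ n = single (single v n) 1"
  by (induction n) (auto simp: mvar_def mult_single simp flip: single_add)

text \<open>The map \<open>f\<close> need not be injective: exponents of variables with a common
  image add up.\<close>

definition rename :: "('v \<Rightarrow> 'w) \<Rightarrow> ('v \<Rightarrow>\<^sub>0 nat) \<Rightarrow> ('w \<Rightarrow>\<^sub>0 nat)" where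
  "rename f t = (\<Sum>v\<in>keys t. single (f v) (lookup t v))"

lemma rename_superset:
  assumes "finite A" "keys t \<subseteq> A"
  shows "rename f t = (\<Sum>v\<in>A. single (f v) (lookup t v))"
  unfolding rename_def using assms
  by (intro sum.mono_neutral_left) (auto simp: in_keys_iff)

lemma rename_0 [simp]: "rename f 0 = 0"
  and rename_single [simp]: "rename f (single v n) = single (f v) n"
  by (simp_all add: rename_def)

lemma rename_add: "rename f (s + t) = rename f s + rename f t"
proof -
  let ?A = "keys s \<union> keys t"
  have "keys (s + t) \<subseteq> ?A" by (rule keys_add)
  then show ?thesis
    by (simp add: rename_superset[of ?A] lookup_add sum.distrib single_add)
qed

lemma subst_mon_rename: "subst_mon (\<lambda>v. mvar (f v)) t = single (rename f t) 1"
  by (rule poly_mapping_single_induct[of _ UNIV t])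
    (auto simp: subst_mon_add mult_single mvar_power rename_add)

lemma poly_subst_rename: "poly_subst (\<lambda>v. mvar (f v)) p = lin (\<lambda>t. single (rename f t) 1) p"
  by (simp add: poly_subst_lin subst_mon_rename[abs_def])

lemma rename_id [simp]: "rename (\<lambda>v. v) t = t"
  by (rule poly_mapping_single_induct[of _ UNIV t]) (auto simp: rename_add)

lemma poly_subst_mvar_id [simp]: "poly_subst mvar p = p"
  using poly_subst_rename[of "\<lambda>v. v" p] by simp

subsection \<open>Ideals\<close>

lemma ideal_gen_0 [simp]: "0 \<in> ideal_gen G"
  unfolding ideal_gen_def by (auto intro!: exI[of _ "{}"])

lemma ideal_gen_mult_gen: "g \<in> G \<Longrightarrow> a * g \<in> ideal_gen G"
  unfolding ideal_gen_def by (auto intro!: exI[of _ "{g}"] exI[of _ "\<lambda>_. a"])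

lemma ideal_gen_base: "g \<in> G \<Longrightarrow> g \<in> ideal_gen G"
  using ideal_gen_mult_gen[of g G 1] by simp

lemma ideal_gen_add:
  assumes "p \<in> ideal_gen G" "q \<in> ideal_gen G"
  shows "p + q \<in> ideal_gen G"
proof -
  obtain A a where A: "finite A" "A \<subseteq> G" "p = (\<Sum>g\<in>A. a g * g)"
    using assms(1) by (auto simp: ideal_gen_def)
  obtain B b where B: "finite B" "B \<subseteq> G" "q = (\<Sum>g\<in>B. b g * g)"
    using assms(2) by (auto simp: ideal_gen_def)
  have "p = (\<Sum>g\<in>A \<union> B. (if g \<in> A then a g else 0) * g)"
    unfolding A(3) using A B by (intro sum.mono_neutral_cong_left) auto
  moreover have "q = (\<Sum>g\<in>A \<union> B. (if g \<in> B then b g else 0) * g)"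
    unfolding B(3) using A B by (intro sum.mono_neutral_cong_left) auto
  ultimately have "p + q = (\<Sum>g\<in>A \<union> B.
      ((if g \<in> A then a g else 0) + (if g \<in> B then b g else 0)) * g)"
    by (simp only: sum.distrib distrib_right)
  then show ?thesis
    unfolding ideal_gen_def mem_Collect_eq
    using A B by (intro exI[of _ "A \<union> B"] exI conjI) auto
qed

lemma ideal_gen_mult: "p \<in> ideal_gen G \<Longrightarrow> a * p \<in> ideal_gen G"
proof -
  assume "p \<in> ideal_gen G"
  then obtain A b where A: "finite A" "A \<subseteq> G" "p = (\<Sum>g\<in>A. b g * g)"
    by (auto simp: ideal_gen_def)
  then have "a * p = (\<Sum>g\<in>A. (a * b g) * g)"
    by (simp add: sum_distrib_left mult.assoc)
  with A show ?thesis
    unfolding ideal_gen_def mem_Collect_eq by (intro exI[of _ A] exI[of _ "\<lambda>g. a * b g"]) simp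
qed

lemma ideal_gen_smul: "p \<in> ideal_gen G \<Longrightarrow> smul c p \<in> ideal_gen G"
  by (metis ideal_gen_mult mconst_mult)

lemma ideal_gen_diff: "p \<in> ideal_gen G \<Longrightarrow> q \<in> ideal_gen G \<Longrightarrow> p - q \<in> ideal_gen G"
  using ideal_gen_add[of p G "- q"] ideal_gen_mult[of q G "-1"] by simp

lemma ideal_gen_sum: "(\<And>i. i \<in> A \<Longrightarrow> f i \<in> ideal_gen G) \<Longrightarrow> (\<Sum>i\<in>A. f i) \<in> ideal_gen G"
  by (induction A rule: infinite_finite_induct) (auto intro: ideal_gen_add)

lemma ideal_gen_induct [consumes 1, case_names zero add gen]:
  assumes "f \<in> ideal_gen G" "P 0" "\<And>p q. P p \<Longrightarrow> P q \<Longrightarrow> P (p + q)"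
    "\<And>a g. g \<in> G \<Longrightarrow> P (a * g)"
  shows "P f"
proof -
  obtain A a where A: "finite A" "A \<subseteq> G" "f = (\<Sum>g\<in>A. a g * g)"
    using assms(1) by (auto simp: ideal_gen_def)
  from A(1,2) show ?thesis unfolding A(3)
    by (induction A rule: finite_induct) (use assms in auto)
qed

text \<open>Splitting the multipliers into terms lets arguments about gradings and tensor factors
  treat only monomial multiples of generators.\<close>

lemma ideal_gen_term_induct [consumes 1, case_names zero add gen]:
  assumes "f \<in> ideal_gen G" "P 0" "\<And>p q. P p \<Longrightarrow> P q \<Longrightarrow> P (p + q)"
    "\<And>t c g. g \<in> G \<Longrightarrow> P (single t c * g)"
  shows "P f"
  using assms(1)
proof (induction rule: ideal_gen_induct)
  case (gen a g)
  show ?case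
    by (rule poly_mapping_single_induct[of _ UNIV a]) (use assms gen in \<open>auto simp: distrib_right\<close>)
qed (use assms in auto)

lemma ideal_gen_subset: "G \<subseteq> ideal_gen H \<Longrightarrow> ideal_gen G \<subseteq> ideal_gen H"
proof
  fix f assume "G \<subseteq> ideal_gen H" "f \<in> ideal_gen G"
  from this(2,1) show "f \<in> ideal_gen H"
    by (induction rule: ideal_gen_induct) (auto intro: ideal_gen_add ideal_gen_mult)
qed

lemma poly_subst_ideal_gen:
  assumes "p \<in> ideal_gen G" "\<And>g. g \<in> G \<Longrightarrow> poly_subst \<sigma> g \<in> ideal_gen H"
  shows "poly_subst \<sigma> p \<in> ideal_gen H"
  using assms(1)
  by (induction rule: ideal_gen_induct)
    (auto simp: poly_subst_add poly_subst_mult intro: ideal_gen_add ideal_gen_mult assms(2))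

lemma poly_in_iff: "p \<in> poly_in Vs \<longleftrightarrow> keys p \<subseteq> {t. keys t \<subseteq> Vs}"
  by (auto simp: poly_in_def)

lemma poly_in_add: "p \<in> poly_in Vs \<Longrightarrow> q \<in> poly_in Vs \<Longrightarrow> p + q \<in> poly_in Vs"
  using keys_add[of p q] by (auto simp: poly_in_iff)

lemma poly_in_0 [simp]: "0 \<in> poly_in Vs"
  by (simp add: poly_in_iff)

lemma poly_in_smul: "p \<in> poly_in Vs \<Longrightarrow> smul c p \<in> poly_in Vs"
  by (force simp: poly_in_def in_keys_iff)

lemma poly_in_diff: "p \<in> poly_in Vs \<Longrightarrow> q \<in> poly_in Vs \<Longrightarrow> p - q \<in> poly_in Vs"
  using keys_diff[of p q] by (auto simp: poly_in_iff)

lemma poly_in_sum: "(\<And>i. i \<in> A \<Longrightarrow> f i \<in> poly_in Vs) \<Longrightarrow> (\<Sum>i\<in>A. f i) \<in> poly_in Vs"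
  by (induction A rule: infinite_finite_induct) (auto intro: poly_in_add)

lemma poly_in_mult: "(p :: ('a, 'k::comm_ring_1) mpoly) \<in> poly_in Vs \<Longrightarrow> q \<in> poly_in Vs \<Longrightarrow> p * q \<in> poly_in Vs"
proof -
  assume "p \<in> poly_in Vs" "q \<in> poly_in Vs"
  moreover have "\<exists>s\<in>keys p. \<exists>t\<in>keys q. u = s + t" if "u \<in> keys (p * q)" for u
    using keys_mult[of p q] that by blast
  moreover have "keys (s + t) \<subseteq> keys s \<union> keys t" for s t :: "'a \<Rightarrow>\<^sub>0 nat"
    by (rule keys_add)
  ultimately show ?thesis unfolding poly_in_def by blast
qed

lemma poly_in_mvar: "v \<in> Vs \<Longrightarrow> mvar v \<in> poly_in Vs"
  by (auto simp: poly_in_iff mvar_def)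

lemma poly_in_induct [consumes 1, case_names zero one smul add mult]:
  assumes "p \<in> poly_in Vs" "P 0" "P 1" "\<And>c p. P p \<Longrightarrow> P (smul c p)"
    "\<And>p q. P p \<Longrightarrow> P q \<Longrightarrow> P (p + q)" "\<And>p v. P p \<Longrightarrow> v \<in> Vs \<Longrightarrow> P (mvar v * p)"
  shows "P p"
proof -
  have pow: "P (mvar v ^ n * q)" if "v \<in> Vs" "P q" for v n q
    using that by (induction n) (auto simp: mult.assoc intro: assms)
  have mon: "P (single t 1)" if "keys t \<subseteq> Vs" for t
  proof (rule poly_mapping_single_induct[of _ Vs t])
    show "P (single (s + single v n) 1)" if "P (single s 1)" "v \<in> Vs" for s v n
      using pow[OF that(2,1), of n] by (simp add: mvar_power mult_single add.commute)
  qed (use that assms in auto)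
  show ?thesis
  proof (rule poly_mapping_single_induct[of _ "{t. keys t \<subseteq> Vs}" p])
    show "P (q + single t c)" if "P q" "t \<in> {t. keys t \<subseteq> Vs}" for q t c
      using assms(4)[OF mon, of t c] that assms(5) by simp
  qed (use assms in \<open>auto simp: poly_in_iff\<close>)
qed

subsection \<open>Joins of kernels\<close>

text \<open>A basis of \<open>U\<close> stays independent after adjoining \<open>x\<close>, so the
  function that is 1 at \<open>x\<close> and 0 on the basis extends linearly to the whole space,
  which may have infinite dimension.\<close>

lemma exists_separating_functional:
  fixes U :: "('a \<Rightarrow>\<^sub>0 'k::field) set"
  assumes "0 \<in> U" "\<And>p q. p \<in> U \<Longrightarrow> q \<in> U \<Longrightarrow> p + q \<in> U" "\<And>c p. p \<in> U \<Longrightarrow> smul c p \<in> U" "x \<notin> U"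
  obtains \<phi> :: "('a \<Rightarrow>\<^sub>0 'k) \<Rightarrow> 'k" where
    "\<And>p q. \<phi> (p + q) = \<phi> p + \<phi> q" "\<And>c p. \<phi> (smul c p) = c * \<phi> p"
    "\<And>u. u \<in> U \<Longrightarrow> \<phi> u = 0" "\<phi> x = 1"
proof -
  interpret vs: vector_space "smul :: 'k \<Rightarrow> ('a \<Rightarrow>\<^sub>0 'k) \<Rightarrow> ('a \<Rightarrow>\<^sub>0 'k)"
    by unfold_locales (auto simp: smul_add smul_add_left)
  interpret vector_space_pair "smul :: 'k \<Rightarrow> ('a \<Rightarrow>\<^sub>0 'k) \<Rightarrow> ('a \<Rightarrow>\<^sub>0 'k)" "(*) :: 'k \<Rightarrow> 'k \<Rightarrow> 'k"
    by unfold_locales (auto simp: algebra_simps)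
  obtain B where B: "B \<subseteq> U" "vs.independent B" "U \<subseteq> vs.span B"
    by (rule vs.maximal_independent_subset[of U])
  have "vs.subspace U"
    using assms by (auto simp: vs.subspace_def)
  then have "vs.span B \<subseteq> U"
    using B(1) by (rule vs.span_minimal[rotated])
  then have x: "x \<notin> vs.span B" "x \<notin> B"
    using assms(4) B(1) by auto
  then have "vs.independent (insert x B)"
    using B(2) by (intro vs.independent_insertI)
  from linear_independent_extend[OF this, of "\<lambda>y. if y = x then 1 else 0"]
  obtain \<phi> where \<phi>: "Vector_Spaces.linear smul (*) \<phi>" "\<forall>y\<in>insert x B. \<phi> y = (if y = x then 1 else 0)"
    by blast
  interpret \<phi>: Vector_Spaces.linear smul "(*)" \<phi> by fact
  have "\<phi> u = 0" if "u \<in> vs.span B" for u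
    using that by (rule linear_eq_0_on_span[OF \<phi>(1), rotated]) (use \<phi>(2) x in auto)
  then show thesis
    using \<phi>(2) B(3) by (intro that[of \<phi>]) (auto simp: \<phi>.add \<phi>.scale)
qed

lemma poly_subst_rename_single [simp]:
  "poly_subst (\<lambda>v. mvar (f v)) (single t c) = single (rename f t) c"
  by (simp add: poly_subst_rename)

lemma rename_rename: "rename f (rename g t) = rename (\<lambda>v. f (g v)) t"
  by (rule poly_mapping_single_induct[of _ UNIV t]) (auto simp: rename_add)

text \<open>
  The polynomial ring in the variables \<open>(i, v)\<close> is regarded as the tensor product of the
  ring in the variables \<open>(0, v)\<close> and the ring in the variables \<open>(Suc i, v)\<close>.
\<close>

abbreviation in0 :: "('a, 'k::comm_ring_1) mpoly \<Rightarrow> (nat \<times> 'a, 'k) mpoly" where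
  "in0 \<equiv> poly_subst (\<lambda>v. mvar (0, v))"

abbreviation inS :: "(nat \<times> 'a, 'k::comm_ring_1) mpoly \<Rightarrow> (nat \<times> 'a, 'k) mpoly" where
  "inS \<equiv> poly_subst (\<lambda>v. mvar (apfst Suc v))"

abbreviation mon_hd :: "(nat \<times> 'a \<Rightarrow>\<^sub>0 nat) \<Rightarrow> ('a \<Rightarrow>\<^sub>0 nat)" where
  "mon_hd \<equiv> Poly_Mapping.map_key (Pair 0)"

abbreviation mon_tl :: "(nat \<times> 'a \<Rightarrow>\<^sub>0 nat) \<Rightarrow> (nat \<times> 'a \<Rightarrow>\<^sub>0 nat)" where
  "mon_tl \<equiv> Poly_Mapping.map_key (apfst Suc)"

lemma inj_Pair_apfst_Suc: "inj (Pair (0::nat))" "inj (apfst Suc)"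
  by (auto simp: inj_on_def)

lemma mon_hd_tl_add:
  "mon_hd 0 = 0" "mon_tl 0 = 0"
  "mon_hd (s + t) = mon_hd s + mon_hd t" "mon_tl (s + t) = mon_tl s + mon_tl t"
  by (simp_all add: map_key_plus inj_Pair_apfst_Suc)

lemma mon_hd_tl_single:
  "mon_hd (single (0, v) n) = single v n" "mon_tl (single (0, v) n) = 0"
  "mon_hd (single (Suc i, v) n) = 0" "mon_tl (single (Suc i, v) n) = single (i, v) n"
  by (auto intro!: poly_mapping_eqI simp: Poly_Mapping.map_key.rep_eq inj_Pair_apfst_Suc
      lookup_single when_def)

lemma mon_hd_tl_rename:
  "mon_hd (rename (Pair 0) s) = s" "mon_tl (rename (Pair 0) s) = 0"
  "mon_hd (rename (apfst Suc) t) = 0" "mon_tl (rename (apfst Suc) t) = t"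
     apply (rule poly_mapping_single_induct[of _ UNIV s];
        simp add: rename_add mon_hd_tl_add mon_hd_tl_single)+
   apply (rule poly_mapping_single_induct[of _ UNIV t];
      auto simp add: rename_add mon_hd_tl_add mon_hd_tl_single)+
  done

lemma rename_mon_hd_tl:
  fixes u :: "nat \<times> 'a \<Rightarrow>\<^sub>0 nat"
  shows "rename (Pair 0) (mon_hd u) + rename (apfst Suc) (mon_tl u) = u"
proof (rule poly_mapping_single_induct[of _ UNIV u])
  fix p :: "nat \<times> 'a \<Rightarrow>\<^sub>0 nat" and v :: "nat \<times> 'a" and n :: nat
  assume *: "rename (Pair 0) (mon_hd p) + rename (apfst Suc) (mon_tl p) = p"
  obtain i w where v: "v = (i, w)" by (cases v)
  have "rename (Pair 0) (mon_hd (single v n)) + rename (apfst Suc) (mon_tl (single v n)) = single v n"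
    unfolding v by (cases i) (auto simp: mon_hd_tl_single)
  with * show "rename (Pair 0) (mon_hd (p + single v n)) + rename (apfst Suc) (mon_tl (p + single v n))
      = p + single v n"
    by (simp add: mon_hd_tl_add rename_add add_ac)
qed (auto simp: mon_hd_tl_add)

section \<open>Contraction of the first tensor factor\<close>

context
  fixes \<phi> :: "('a, 'k::field) mpoly \<Rightarrow> 'k"
  assumes \<phi>_add: "\<And>p q. \<phi> (p + q) = \<phi> p + \<phi> q"
    and \<phi>_smul: "\<And>c p. \<phi> (smul c p) = c * \<phi> p"
begin

text \<open>The functional \<open>\<phi>\<close> on copy 0 tensored with the identity on the
  remaining copies, whose indices are shifted down by one.\<close>

definition contract :: "(nat \<times> 'a, 'k) mpoly \<Rightarrow> (nat \<times> 'a, 'k) mpoly" where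
  "contract = lin (\<lambda>u. smul (\<phi> (single (mon_hd u) 1)) (single (mon_tl u) 1))"

lemma contract_add: "contract (p + q) = contract p + contract q"
  and contract_smul: "contract (smul c p) = smul c (contract p)"
  and contract_sum: "contract (\<Sum>i\<in>A. f i) = (\<Sum>i\<in>A. contract (f i))"
  and contract_0: "contract 0 = 0"
  by (simp_all add: contract_def lin_add lin_smul lin_sum)

lemma contract_tensor: "contract (in0 p * inS q) = smul (\<phi> p) q"
proof (rule poly_mapping_single_induct[of _ UNIV p])
  show "contract (in0 0 * inS q) = smul (\<phi> 0) q"
    using \<phi>_smul[of 0 0] by (simp add: contract_def)
next
  fix p t c assume *: "contract (in0 p * inS q) = smul (\<phi> p) q"
  have "contract (in0 (single t c) * inS q) = smul (\<phi> (single t c)) q"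
  proof (rule poly_mapping_single_induct[of _ UNIV q])
    fix q u b assume *: "contract (in0 (single t c) * inS q) = smul (\<phi> (single t c)) q"
    have "contract (in0 (single t c) * inS (single u b)) = smul (\<phi> (single t c)) (single u b)"
      using \<phi>_smul[of c "single t 1"]
      by (simp add: contract_def mult_single mon_hd_tl_add mon_hd_tl_rename mult_ac)
    with * show "contract (in0 (single t c) * inS (q + single u b)) = smul (\<phi> (single t c)) (q + single u b)"
      by (simp add: poly_subst_add distrib_left contract_def lin_add smul_add del: poly_subst_rename_single)
  qed (auto simp: contract_def)
  with * show "contract (in0 (p + single t c) * inS q) = smul (\<phi> (p + single t c)) q"
    by (simp add: poly_subst_add distrib_right contract_def lin_add smul_add_left \<phi>_add
        del: poly_subst_rename_single)
qed auto

text \<open>Multiples of a generator from copy 0 still have their first tensor factor in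
  \<open>ideal_gen G\<close>, where \<open>\<phi>\<close> vanishes. In multiples of the other
  generators the second factor lies in \<open>ideal_gen H\<close>, and contraction only scales
  it.\<close>

lemma contract_ideal:
  assumes "f \<in> ideal_gen (in0 ` ideal_gen G \<union> inS ` ideal_gen H)" "\<And>a. a \<in> ideal_gen G \<Longrightarrow> \<phi> a = 0"
  shows "contract f \<in> ideal_gen H"
  using assms(1)
proof (induction rule: ideal_gen_term_induct)
  case (gen u c g)
  have u: "single u c = smul c (in0 (single (mon_hd u) 1) * inS (single (mon_tl u) 1))"
    by (simp add: mult_single rename_mon_hd_tl)
  from gen consider a where "a \<in> ideal_gen G" "g = in0 a" | b where "b \<in> ideal_gen H" "g = inS b"
    by blast
  then show ?case
  proof cases
    case 1
    have "single u c * g = smul c (in0 (single (mon_hd u) 1 * a) * inS (single (mon_tl u) 1))"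
      unfolding u 1(2) poly_subst_mult by (simp add: smul_mult_left smul_mult_right mult_ac)
    moreover have "\<phi> (single (mon_hd u) 1 * a) = 0"
      using assms(2) 1(1) ideal_gen_mult by blast
    ultimately show ?thesis
      by (simp only: contract_smul contract_tensor) simp
  next
    case 2
    have "single u c * g = smul c (in0 (single (mon_hd u) 1) * inS (single (mon_tl u) 1 * b))"
      unfolding u 2(2) poly_subst_mult by (simp add: smul_mult_left smul_mult_right mult_ac)
    then have "contract (single u c * g) = smul c (smul (\<phi> (single (mon_hd u) 1)) (single (mon_tl u) 1 * b))"
      by (simp only: contract_smul contract_tensor)
    then show ?thesis
      using 2(1) by (auto intro: ideal_gen_smul ideal_gen_mult)
  qed
qed (auto simp: contract_0 contract_add intro: ideal_gen_add)

end

text \<open>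
  Over a field, the kernel of a tensor product of two maps is generated by their kernels. A tensor
  \<open>\<Sum>k<N. p k \<otimes> q k\<close> in the kernel is shortened as follows: if the image of \<open>p N\<close> depends linearly
  on the others, it can be absorbed into them modulo the kernel of \<open>\<alpha>\<close>, and otherwise contracting
  with a functional that isolates it shows that \<open>q N\<close> lies in the kernel of \<open>\<beta>\<close>.
\<close>

lemma tensor_kernel:
  fixes \<alpha> :: "'v \<Rightarrow> ('a, 'k::field) mpoly" and \<beta> :: "'v \<Rightarrow> (nat \<times> 'a, 'k) mpoly"
    and G :: "('a, 'k) mpoly set" and H :: "(nat \<times> 'a, 'k) mpoly set" and Vs :: "'v set"
    and N :: nat
  defines "K \<equiv> {f \<in> poly_in Vs. poly_subst \<alpha> f \<in> ideal_gen G}"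
    and "L \<equiv> {f \<in> poly_in Vs. poly_subst \<beta> f \<in> ideal_gen H}"
  assumes "\<And>k. k < N \<Longrightarrow> p k \<in> poly_in Vs" "\<And>k. k < N \<Longrightarrow> q k \<in> poly_in Vs"
    and "(\<Sum>k<N. in0 (poly_subst \<alpha> (p k)) * inS (poly_subst \<beta> (q k)))
      \<in> ideal_gen (in0 ` ideal_gen G \<union> inS ` ideal_gen H)"
  shows "(\<Sum>k<N. poly_subst (\<lambda>v. mvar (v, False)) (p k) * poly_subst (\<lambda>v. mvar (v, True)) (q k))
      \<in> ideal_gen (poly_subst (\<lambda>v. mvar (v, False)) ` K \<union> poly_subst (\<lambda>v. mvar (v, True)) ` L)"
  using assms(3-)
proof (induction N arbitrary: p q)
  case (Suc N)
  let ?F = "poly_subst (\<lambda>v. mvar (v, False)) :: ('v, 'k) mpoly \<Rightarrow> _"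
  let ?T = "poly_subst (\<lambda>v. mvar (v, True)) :: ('v, 'k) mpoly \<Rightarrow> _"
  let ?a = "\<lambda>k. poly_subst \<alpha> (p k)" and ?b = "\<lambda>k. poly_subst \<beta> (q k)"
  let ?I = "ideal_gen (in0 ` ideal_gen G \<union> inS ` ideal_gen H)"
  \<comment> \<open>Membership of \<open>?a N\<close> in \<open>U\<close> expresses linear
    dependence on the earlier images modulo \<open>ideal_gen G\<close>.\<close>
  define U where "U = {u + (\<Sum>k<N. smul (c k) (?a k)) |u c. u \<in> ideal_gen G}"
  show ?case
  proof (cases "?a N \<in> U")
    case True
    then obtain u c where u: "u \<in> ideal_gen G" "?a N = u + (\<Sum>k<N. smul (c k) (?a k))"
      by (auto simp: U_def)
    define p' where "p' = p N - (\<Sum>k<N. smul (c k) (p k))"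
    have p': "poly_subst \<alpha> p' = u"
      by (simp add: p'_def poly_subst_diff poly_subst_sum poly_subst_smul u(2))
    then have K: "p' \<in> K"
      using Suc.prems(1) u(1) by (auto simp: K_def p'_def intro!: poly_in_diff poly_in_sum poly_in_smul)
    \<comment> \<open>The right factor \<open>q N\<close> is distributed over the earlier terms with
      the coefficients of the dependence; what remains of \<open>p N\<close> is \<open>p'\<close>,
      which lies in \<open>K\<close>.\<close>
    define q' where "q' k = q k + smul (c k) (q N)" for k
    have pN: "p N = p' + (\<Sum>k<N. smul (c k) (p k))"
      by (simp add: p'_def)
    have 1: "(\<Sum>k<Suc N. in0 (?a k) * inS (?b k))
        = in0 u * inS (?b N) + (\<Sum>k<N. in0 (?a k) * inS (poly_subst \<beta> (q' k)))"
      by (simp add: u(2) q'_def poly_subst_add poly_subst_sum poly_subst_smul distrib_left distrib_right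
          sum.distrib sum_distrib_right smul_mult_left smul_mult_right)
    have 2: "(\<Sum>k<Suc N. ?F (p k) * ?T (q k)) = ?F p' * ?T (q N) + (\<Sum>k<N. ?F (p k) * ?T (q' k))"
      by (simp add: pN q'_def poly_subst_add poly_subst_sum poly_subst_smul distrib_left distrib_right
          sum.distrib sum_distrib_right smul_mult_left smul_mult_right)
    have "in0 u * inS (?b N) \<in> ?I"
      using u(1) by (subst mult.commute) (intro ideal_gen_mult_gen, blast)
    from ideal_gen_diff[OF Suc.prems(3) this]
    have "(\<Sum>k<N. in0 (?a k) * inS (poly_subst \<beta> (q' k))) \<in> ?I"
      unfolding 1 by simp
    then have "(\<Sum>k<N. ?F (p k) * ?T (q' k)) \<in> ideal_gen (?F ` K \<union> ?T ` L)"
      using Suc.prems(1,2) by (intro Suc.IH) (auto simp: q'_def intro!: poly_in_add poly_in_smul)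
    moreover have "?F p' * ?T (q N) \<in> ideal_gen (?F ` K \<union> ?T ` L)"
      using K by (subst mult.commute) (intro ideal_gen_mult_gen, blast)
    ultimately show ?thesis unfolding 2 by (intro ideal_gen_add)
  next
    case False
    have U0: "u \<in> U" if "u \<in> ideal_gen G" for u
      unfolding U_def mem_Collect_eq by (rule exI[of _ u], rule exI[of _ "\<lambda>_. 0"]) (simp add: that)
    have Uk: "?a k \<in> U" if "k < N" for k
      unfolding U_def mem_Collect_eq
    proof (rule exI[of _ 0], rule exI[of _ "\<lambda>j. if j = k then 1 else 0"])
      have "(\<Sum>j<N. smul (if j = k then 1 else 0) (?a j)) = (\<Sum>j<N. if j = k then ?a j else 0)"
        by (rule sum.cong) auto
      then show "?a k = 0 + (\<Sum>j<N. smul (if j = k then 1 else 0) (?a j)) \<and> 0 \<in> ideal_gen G"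
        using that by simp
    qed
    obtain \<phi> where \<phi>: "\<And>p q. \<phi> (p + q) = \<phi> p + \<phi> q" "\<And>c p. \<phi> (smul c p) = c * \<phi> p"
      "\<And>u. u \<in> U \<Longrightarrow> \<phi> u = 0" "\<phi> (?a N) = 1"
    proof (rule exists_separating_functional[of U "?a N"])
      show "0 \<in> U" by (simp add: U0)
      show "x + y \<in> U" if xy: "x \<in> U" "y \<in> U" for x y
      proof -
        obtain u c u' c' where *: "u \<in> ideal_gen G" "u' \<in> ideal_gen G"
          "x = u + (\<Sum>k<N. smul (c k) (?a k))" "y = u' + (\<Sum>k<N. smul (c' k) (?a k))"
          using xy by (auto simp: U_def)
        show ?thesis
          unfolding U_def mem_Collect_eq
          by (rule exI[of _ "u + u'"], rule exI[of _ "\<lambda>k. c k + c' k"])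
            (use * in \<open>auto simp: smul_add_left sum.distrib intro: ideal_gen_add\<close>)
      qed
      show "smul b x \<in> U" if x: "x \<in> U" for b x
      proof -
        obtain u c where *: "u \<in> ideal_gen G" "x = u + (\<Sum>k<N. smul (c k) (?a k))"
          using x by (auto simp: U_def)
        show ?thesis
          unfolding U_def mem_Collect_eq
          by (rule exI[of _ "smul b u"], rule exI[of _ "\<lambda>k. b * c k"])
            (use * in \<open>auto simp: smul_add smul_sum intro: ideal_gen_smul\<close>)
      qed
    qed (use False in auto)
    have "contract \<phi> (\<Sum>k<Suc N. in0 (?a k) * inS (?b k)) = (\<Sum>k<Suc N. smul (\<phi> (?a k)) (?b k))"
      by (simp only: contract_tensor[OF \<phi>(1,2)] contract_sum[OF \<phi>(1,2)])
    also have "\<dots> = ?b N"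
      using Uk by (simp add: \<phi>)
    finally have "?b N \<in> ideal_gen H"
      using contract_ideal[OF \<phi>(1,2) Suc.prems(3)] U0 \<phi>(3) by metis
    then have L: "q N \<in> L"
      using Suc.prems(2) by (auto simp: L_def)
    have "in0 (?a N) * inS (?b N) \<in> ?I"
      using \<open>?b N \<in> ideal_gen H\<close> by (intro ideal_gen_mult_gen) blast
    from ideal_gen_diff[OF Suc.prems(3) this]
    have "(\<Sum>k<N. in0 (?a k) * inS (?b k)) \<in> ?I"
      by simp
    then have "(\<Sum>k<N. ?F (p k) * ?T (q k)) \<in> ideal_gen (?F ` K \<union> ?T ` L)"
      using Suc.prems(1,2) by (intro Suc.IH) auto
    moreover have "?F (p N) * ?T (q N) \<in> ideal_gen (?F ` K \<union> ?T ` L)"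
      using L by (intro ideal_gen_mult_gen) blast
    ultimately show ?thesis by (auto intro: ideal_gen_add)
  qed
qed simp

text \<open>Multiplication by a variable \<open>v\<close> turns a tensor of \<open>p\<close> and
  \<open>q\<close> into that of \<open>v * p\<close> and \<open>q\<close> plus that of
  \<open>p\<close> and \<open>v * q\<close>, so the shape is preserved while \<open>f\<close> is
  built up one variable at a time. Lists of pairs allow repeated tensors.\<close>

lemma comultiplication_tensor:
  fixes f :: "('v, 'k::comm_ring_1) mpoly"
  assumes "f \<in> poly_in Vs"
  obtains N :: nat and p q where "\<And>k. k < N \<Longrightarrow> p k \<in> poly_in Vs" "\<And>k. k < N \<Longrightarrow> q k \<in> poly_in Vs"
    "poly_subst (\<lambda>v. mvar (v, False) + mvar (v, True)) f
      = (\<Sum>k<N. poly_subst (\<lambda>v. mvar (v, False)) (p k) * poly_subst (\<lambda>v. mvar (v, True)) (q k))"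
proof -
  let ?F = "poly_subst (\<lambda>v. mvar (v, False)) :: ('v, 'k) mpoly \<Rightarrow> _"
  let ?T = "poly_subst (\<lambda>v. mvar (v, True)) :: ('v, 'k) mpoly \<Rightarrow> _"
  let ?D = "poly_subst (\<lambda>v. mvar (v, False) + mvar (v, True)) :: ('v, 'k) mpoly \<Rightarrow> _"
  let ?S = "\<lambda>xs. \<Sum>(p, q)\<leftarrow>xs. ?F p * ?T q"
  have "\<exists>xs. set xs \<subseteq> poly_in Vs \<times> poly_in Vs \<and> ?D f = ?S xs"
    using assms
  proof (induction rule: poly_in_induct)
    case one
    show ?case by (rule exI[of _ "[(1, 1)]"]) (auto simp: poly_in_def)
  next
    case (smul c p)
    then obtain xs where xs: "set xs \<subseteq> poly_in Vs \<times> poly_in Vs" "?D p = ?S xs" by blast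
    have "smul c (?S xs) = ?S (map (\<lambda>(p, q). (smul c p, q)) xs)"
      by (induction xs) (auto simp: smul_add poly_subst_smul smul_mult_left)
    then show ?case
      using xs by (intro exI[of _ "map (\<lambda>(p, q). (smul c p, q)) xs"])
        (auto simp: poly_subst_smul intro: poly_in_smul)
  next
    case (add p q)
    then obtain xs ys where "set xs \<subseteq> poly_in Vs \<times> poly_in Vs" "?D p = ?S xs"
      "set ys \<subseteq> poly_in Vs \<times> poly_in Vs" "?D q = ?S ys" by blast
    then show ?case by (intro exI[of _ "xs @ ys"]) (auto simp: poly_subst_add)
  next
    case (mult p v)
    then obtain xs where xs: "set xs \<subseteq> poly_in Vs \<times> poly_in Vs" "?D p = ?S xs" by blast
    let ?xs = "map (\<lambda>(p, q). (mvar v * p, q)) xs @ map (\<lambda>(p, q). (p, mvar v * q)) xs"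
    have "(mvar (v, False) + mvar (v, True)) * ?S xs = ?S ?xs"
      by (induction xs) (auto simp: algebra_simps poly_subst_mult)
    then show ?case
      using xs mult(2)
      by (intro exI[of _ ?xs]) (auto simp: poly_subst_mult intro!: poly_in_mult poly_in_mvar)
  qed (auto intro: exI[of _ "[]"])
  then obtain xs where xs: "set xs \<subseteq> poly_in Vs \<times> poly_in Vs" "?D f = ?S xs" by blast
  have "?S xs = (\<Sum>k<length xs. ?F (fst (xs ! k)) * ?T (snd (xs ! k)))"
    by (simp add: sum_list_sum_nth case_prod_beta atLeast0LessThan)
  moreover have "xs ! k \<in> poly_in Vs \<times> poly_in Vs" if "k < length xs" for k
    using xs(1) that by (meson nth_mem subsetD)
  ultimately show thesis
    using xs(2) by (intro that[of "length xs" "\<lambda>k. fst (xs ! k)" "\<lambda>k. snd (xs ! k)"])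
      (force simp: mem_Times_iff)+
qed

text \<open>The join of two kernels is the kernel of the sum of the two maps into separate sets of
  variables. One inclusion maps generators to generators; the other expands the comultiplication
  into tensors and applies \<open>tensor_kernel\<close>.\<close>

lemma join_ideal_kernels:
  fixes \<alpha> :: "'v \<Rightarrow> ('a, 'k::field) mpoly" and \<beta> :: "'v \<Rightarrow> (nat \<times> 'a, 'k) mpoly"
  shows "join_ideal Vs {f \<in> poly_in Vs. poly_subst \<alpha> f \<in> ideal_gen G}
      {f \<in> poly_in Vs. poly_subst \<beta> f \<in> ideal_gen H}
    = {f \<in> poly_in Vs. poly_subst (\<lambda>v. in0 (\<alpha> v) + inS (\<beta> v)) f
        \<in> ideal_gen (in0 ` ideal_gen G \<union> inS ` ideal_gen H)}"
proof (intro set_eqI)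
  fix f :: "('v, 'k) mpoly"
  let ?K = "{f \<in> poly_in Vs. poly_subst \<alpha> f \<in> ideal_gen G}"
  let ?L = "{f \<in> poly_in Vs. poly_subst \<beta> f \<in> ideal_gen H}"
  let ?F = "poly_subst (\<lambda>v. mvar (v, False)) :: ('v, 'k) mpoly \<Rightarrow> _"
  let ?T = "poly_subst (\<lambda>v. mvar (v, True)) :: ('v, 'k) mpoly \<Rightarrow> _"
  let ?D = "poly_subst (\<lambda>v. mvar (v, False) + mvar (v, True)) :: ('v, 'k) mpoly \<Rightarrow> _"
  let ?I = "ideal_gen (in0 ` ideal_gen G \<union> inS ` ideal_gen H)"
  \<comment> \<open>The tensor product of the substitutions \<open>\<alpha>\<close> and
    \<open>\<beta>\<close>, acting on the two copies of the coordinates.\<close>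
  let ?\<Phi> = "poly_subst (\<lambda>(v, b). if b then inS (\<beta> v) else in0 (\<alpha> v))"
  have \<Phi>: "?\<Phi> (?D g) = poly_subst (\<lambda>v. in0 (\<alpha> v) + inS (\<beta> v)) g"
    "?\<Phi> (?F g) = in0 (poly_subst \<alpha> g)" "?\<Phi> (?T g) = inS (poly_subst \<beta> g)" for g
    by (simp_all add: poly_subst_poly_subst poly_subst_add)
  have "?D f \<in> ideal_gen (?F ` ?K \<union> ?T ` ?L) \<longleftrightarrow> ?\<Phi> (?D f) \<in> ?I" if f: "f \<in> poly_in Vs"
  proof
    assume "?D f \<in> ideal_gen (?F ` ?K \<union> ?T ` ?L)"
    then show "?\<Phi> (?D f) \<in> ?I"
      by (rule poly_subst_ideal_gen) (auto simp: \<Phi> intro!: ideal_gen_base)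
  next
    assume *: "?\<Phi> (?D f) \<in> ?I"
    obtain N :: nat and p q where "\<And>k. k < N \<Longrightarrow> p k \<in> poly_in Vs" "\<And>k. k < N \<Longrightarrow> q k \<in> poly_in Vs"
      "?D f = (\<Sum>k<N. ?F (p k) * ?T (q k))"
      by (rule comultiplication_tensor[OF f]) blast
    with * show "?D f \<in> ideal_gen (?F ` ?K \<union> ?T ` ?L)"
      using tensor_kernel[of N p Vs q \<alpha> \<beta> G H] by (simp add: poly_subst_sum poly_subst_mult \<Phi>)
  qed
  then show "f \<in> join_ideal Vs ?K ?L \<longleftrightarrow>
      f \<in> {f \<in> poly_in Vs. poly_subst (\<lambda>v. in0 (\<alpha> v) + inS (\<beta> v)) f \<in> ?I}"
    by (auto simp: join_ideal_def \<Phi>)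
qed

section \<open>The secant ideal as the kernel of one substitution\<close>

definition power_ideal :: "nat \<Rightarrow> ('a, 'k::comm_ring_1) mpoly set \<Rightarrow> (nat \<times> 'a, 'k) mpoly set" where
  "power_ideal r K = ideal_gen (\<Union>i<r. poly_subst (\<lambda>v. mvar (i, v)) ` K)"

text \<open>If \<open>K\<close> is the ideal of a scheme, then \<open>power_ideal r K\<close> is the
  ideal of its \<open>r\<close>-fold product. The polynomial \<open>sum_copies r \<mu>\<close> is
  the pullback of the coordinate indexed by \<open>\<mu>\<close> under the map that adds the
  monomial images of \<open>r\<close> points.\<close>

definition sum_copies :: "nat \<Rightarrow> ('a \<Rightarrow>\<^sub>0 nat) \<Rightarrow> (nat \<times> 'a, 'k::comm_ring_1) mpoly" where
  "sum_copies r \<mu> = (\<Sum>i<r. single (rename (Pair i) \<mu>) 1)"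

lemma power_ideal_Suc:
  "ideal_gen (in0 ` ideal_gen G \<union> inS ` power_ideal r (ideal_gen G)) = power_ideal (Suc r) (ideal_gen G)"
proof (intro equalityI)
  let ?R = "power_ideal (Suc r) (ideal_gen G)"
  have 0: "poly_subst (\<lambda>v. mvar (i, v)) a \<in> ?R" if "a \<in> ideal_gen G" "i < Suc r" for a i
    unfolding power_ideal_def using that by (intro ideal_gen_base) blast
  have "inS b \<in> ?R" if "b \<in> power_ideal r (ideal_gen G)" for b
    using that 0 unfolding power_ideal_def
    by (elim poly_subst_ideal_gen) (auto simp: poly_subst_poly_subst)
  then have "in0 ` ideal_gen G \<union> inS ` power_ideal r (ideal_gen G) \<subseteq> ?R"
    using 0 by blast
  then show "ideal_gen (in0 ` ideal_gen G \<union> inS ` power_ideal r (ideal_gen G)) \<subseteq> ?R"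
    unfolding power_ideal_def by (intro ideal_gen_subset)
  show "?R \<subseteq> ideal_gen (in0 ` ideal_gen G \<union> inS ` power_ideal r (ideal_gen G))"
    unfolding power_ideal_def[of "Suc r"]
  proof (intro ideal_gen_subset subsetI)
    fix x assume "x \<in> (\<Union>i<Suc r. poly_subst (\<lambda>v. mvar (i, v)) ` ideal_gen G)"
    then obtain i a where x: "i < Suc r" "a \<in> ideal_gen G" "x = poly_subst (\<lambda>v. mvar (i, v)) a"
      by blast
    show "x \<in> ideal_gen (in0 ` ideal_gen G \<union> inS ` power_ideal r (ideal_gen G))"
    proof (cases i)
      case 0
      with x show ?thesis by (intro ideal_gen_base) blast
    next
      case (Suc j)
      have "x = inS (poly_subst (\<lambda>v. mvar (j, v)) a)"
        by (simp add: x Suc poly_subst_poly_subst)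
      moreover have "poly_subst (\<lambda>v. mvar (j, v)) a \<in> power_ideal r (ideal_gen G)"
        unfolding power_ideal_def using x Suc by (intro ideal_gen_base) auto
      ultimately show ?thesis by (intro ideal_gen_base) blast
    qed
  qed
qed

text \<open>Induction on \<open>r\<close>: each further join adds one more copy of the variables by
  \<open>join_ideal_kernels\<close>, and the ideals match by \<open>power_ideal_Suc\<close>.\<close>

lemma sec_ideal_eq:
  fixes I :: "nat \<Rightarrow> (nat, 'k::field) mpoly set"
  assumes "r \<ge> 1"
  shows "sec_ideal m n I d r = {f \<in> poly_in (sv_mons m n d).
    poly_subst (sum_copies r) f \<in> power_ideal r (prod_ideal m n I)}"
  using assms
proof (induction r rule: dec_induct)
  case base
  let ?A = "poly_subst (\<lambda>\<mu>. single \<mu> 1) :: (_, 'k) mpoly \<Rightarrow> _"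
  have "poly_subst (sum_copies (Suc 0)) f = in0 (?A f)" for f :: "(nat \<times> nat \<Rightarrow>\<^sub>0 nat, 'k) mpoly"
    by (simp add: poly_subst_poly_subst sum_copies_def[abs_def])
  moreover have "in0 g \<in> power_ideal (Suc 0) (prod_ideal m n I) \<longleftrightarrow> g \<in> prod_ideal m n I" for g
  proof
    assume "in0 g \<in> power_ideal (Suc 0) (prod_ideal m n I)"
    \<comment> \<open>Forgetting the copy index is a left inverse of \<open>in0\<close> and maps the
      power ideal back into the original ideal.\<close>
    then have "poly_subst (\<lambda>v. mvar (snd v)) (in0 g) \<in> prod_ideal m n I"
      unfolding power_ideal_def prod_ideal_def
      by (rule poly_subst_ideal_gen) (auto simp: poly_subst_poly_subst)
    then show "g \<in> prod_ideal m n I"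
      by (simp add: poly_subst_poly_subst)
  qed (auto simp: power_ideal_def intro: ideal_gen_base)
  ultimately show ?case
    by (simp add: sec_ideal_def sv_ideal_def)
next
  case (step r)
  obtain s where s: "r = Suc s"
    using step(1) by (cases r) auto
  let ?G = "\<Union>i<m. poly_subst (\<lambda>j. mvar (i, j)) ` I i"
  let ?H = "\<Union>i<r. poly_subst (\<lambda>v. mvar (i, v)) ` ideal_gen ?G"
  have "sec_ideal m n I d (Suc r)
      = join_ideal (sv_mons m n d) (sv_ideal m n I d) (sec_ideal m n I d r)"
    by (simp add: sec_ideal_def s)
  also have "\<dots> = {f \<in> poly_in (sv_mons m n d).
      poly_subst (\<lambda>\<mu>. in0 (single \<mu> 1) + inS (sum_copies r \<mu>)) f
      \<in> ideal_gen (in0 ` ideal_gen ?G \<union> inS ` ideal_gen ?H)}"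
    unfolding step.IH unfolding sv_ideal_def power_ideal_def prod_ideal_def by (rule join_ideal_kernels)
  also have "ideal_gen (in0 ` ideal_gen ?G \<union> inS ` ideal_gen ?H) = power_ideal (Suc r) (prod_ideal m n I)"
    using power_ideal_Suc[of ?G r] by (simp add: power_ideal_def prod_ideal_def)
  also have "(\<lambda>\<mu>. in0 (single \<mu> 1) + inS (sum_copies r \<mu>)) = sum_copies (Suc r)"
    by (rule ext) (simp add: sum_copies_def poly_subst_sum rename_rename sum.lessThan_Suc_shift
        del: sum.lessThan_Suc)
  finally show ?case .
qed

subsection \<open>Higman's lemma\<close>

text \<open>Every infinite sequence in \<open>A\<close> contains a good pair, which is the sequence
  form of well-quasi-ordering.\<close>

definition almost_full_on :: "('a \<Rightarrow> 'a \<Rightarrow> bool) \<Rightarrow> 'a set \<Rightarrow> bool" where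
  "almost_full_on R A \<longleftrightarrow> (\<forall>f::nat \<Rightarrow> 'a. (\<forall>i. f i \<in> A) \<longrightarrow> (\<exists>i j. i < j \<and> R (f i) (f j)))"

lemma almost_full_onD:
  assumes "almost_full_on R A" "\<And>i::nat. f i \<in> A"
  obtains i j where "i < j" "R (f i) (f j)"
  using assms unfolding almost_full_on_def by blast

text \<open>Ramsey's theorem for pairs, coloured by whether \<open>R\<close> holds, yields a
  homogeneous infinite set. The colour must be the good one, since otherwise its enumeration would
  have no good pair.\<close>

lemma almost_full_on_subseq:
  assumes "almost_full_on R A" "\<And>i::nat. f i \<in> A"
  obtains \<phi> :: "nat \<Rightarrow> nat" where "strict_mono \<phi>" "\<And>i j. i < j \<Longrightarrow> R (f (\<phi> i)) (f (\<phi> j))"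
proof -
  \<comment> \<open>\<open>Min\<close> and \<open>Max\<close> recover the order of the two indices
    from an unordered pair.\<close>
  define c :: "nat set \<Rightarrow> nat" where "c X = (if R (f (Min X)) (f (Max X)) then 0 else 1)" for X
  have c: "c {x, y} = (if R (f x) (f y) then 0 else 1)" if "x < y" for x y
    using that by (simp add: c_def)
  obtain Y t where Y: "infinite Y" "\<forall>x\<in>Y. \<forall>y\<in>Y. x \<noteq> y \<longrightarrow> c {x, y} = t"
  proof -
    have "c X < 2" for X by (simp add: c_def)
    then show thesis using Ramsey2[of "UNIV :: nat set" c 2] that by auto
  qed
  let ?\<phi> = "enumerate Y"
  have mono: "strict_mono ?\<phi>"
    using Y(1) by (rule strict_mono_enumerate)
  have t: "c {?\<phi> i, ?\<phi> j} = t" if "i < j" for i j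
    using Y(2) enumerate_in_set[OF Y(1)] less_imp_neq[OF strict_monoD[OF mono that]] by blast
  obtain i j where "i < j" "R (f (?\<phi> i)) (f (?\<phi> j))"
    using almost_full_onD[OF assms(1), of "f \<circ> ?\<phi>"] assms(2) by auto
  then have "t = 0"
    using t[of i j] c strict_monoD[OF mono] by auto
  then have "R (f (?\<phi> i)) (f (?\<phi> j))" if "i < j" for i j
    using t[OF that] c[OF strict_monoD[OF mono that]] by (auto split: if_splits)
  with mono show thesis by (rule that)
qed

text \<open>The proof is Nash-Williams' minimal bad sequence argument.\<close>

theorem higman:
  assumes "almost_full_on R A"
  shows "almost_full_on (list_emb R) (lists A)"
proof (rule ccontr)
  define bad where "bad f \<longleftrightarrow> (\<forall>i. f i \<in> lists A) \<and> (\<forall>i j. i < j \<longrightarrow> \<not> list_emb R (f i) (f j))"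
    for f :: "nat \<Rightarrow> 'a list"
  assume "\<not> almost_full_on (list_emb R) (lists A)"
  then obtain f0 where f0: "bad f0"
    unfolding almost_full_on_def bad_def by blast
  \<comment> \<open>The words \<open>xs\<close> followed by \<open>x\<close> begin some bad
    sequence; \<open>next_word\<close> takes a shortest such \<open>x\<close>.\<close>
  define ext where "ext xs x \<longleftrightarrow> (\<exists>f. bad f \<and> (\<forall>i<length xs. f i = xs ! i) \<and> f (length xs) = x)"
    for xs x
  define next_word where "next_word xs = (ARG_MIN length x. ext xs x)" for xs
  define pre where "pre = rec_nat [] (\<lambda>_ xs. xs @ [next_word xs])"
  define g where "g n = next_word (pre n)" for n
  have pre_Suc: "pre (Suc n) = pre n @ [g n]" for n
    by (simp add: pre_def g_def)
  have len: "length (pre n) = n" for n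
    by (induction n) (auto simp: pre_Suc, simp add: pre_def)
  have nth: "pre n ! i = g i" if "i < n" for i n
    using that by (induction n) (auto simp: pre_Suc nth_append len less_Suc_eq)
  have ex: "\<exists>f. bad f \<and> (\<forall>i<n. f i = g i)" for n
  proof (induction n)
    case (Suc n)
    then obtain f where "bad f" "\<forall>i<n. f i = g i" by blast
    then have "ext (pre n) (f n)"
      by (auto simp: ext_def len nth)
    then have "ext (pre n) (g n)"
      unfolding g_def next_word_def by (rule arg_min_natI)
    then show ?case
      by (auto simp: ext_def len nth less_Suc_eq)
  qed (use f0 in auto)
  have min: "length (g n) \<le> length (f n)" if "bad f" "\<forall>i<n. f i = g i" for f n
  proof -
    have "ext (pre n) (f n)"
      using that by (auto simp: ext_def len nth)
    then show ?thesis
      unfolding g_def next_word_def by (rule arg_min_nat_le)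
  qed
  have bad_g: "bad g"
    unfolding bad_def
  proof (intro conjI allI impI)
    show "g i \<in> lists A" for i
      using ex[of "Suc i"] unfolding bad_def by (metis lessI)
    show "\<not> list_emb R (g i) (g j)" if "i < j" for i j
      using ex[of "Suc j"] that unfolding bad_def by (metis lessI less_SucI)
  qed
  have ne: "g i \<noteq> []" for i
    using bad_g unfolding bad_def by (metis lessI list_emb_Nil)
  have hd_A: "hd (g i) \<in> A" and tl_A: "tl (g i) \<in> lists A" for i
    using bad_g ne[of i] unfolding bad_def by (cases "g i"; metis Cons_in_lists_iff list.sel(1,3))+
  obtain \<phi> :: "nat \<Rightarrow> nat" where \<phi>: "strict_mono \<phi>" "\<And>i j. i < j \<Longrightarrow> R (hd (g (\<phi> i))) (hd (g (\<phi> j)))"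
    using almost_full_on_subseq[OF assms, of "\<lambda>i. hd (g i)"] hd_A by blast
  \<comment> \<open>The minimal sequence is kept below index \<open>\<phi> 0\<close> and continued
    by the tails of the words whose heads form a good subsequence. A good pair in \<open>h\<close>
    would give one in \<open>g\<close>, yet the word at index \<open>\<phi> 0\<close> has become
    shorter.\<close>
  define h where "h i = (if i < \<phi> 0 then g i else tl (g (\<phi> (i - \<phi> 0))))" for i
  have emb_tl: "list_emb R xs (g i)" if "list_emb R xs (tl (g i))" for xs i
    using that ne[of i] by (metis list.collapse list_emb_Cons)
  have bad_gD: "\<not> list_emb R (g i) (g j)" if "i < j" for i j
    using bad_g that unfolding bad_def by blast
  have "\<not> list_emb R (h i) (h j)" if ij: "i < j" for i j
  proof -
    consider "j < \<phi> 0" | "i < \<phi> 0" "\<phi> 0 \<le> j" | "\<phi> 0 \<le> i" using ij by linarith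
    then show ?thesis
    proof cases
      case 1
      then show ?thesis using bad_gD ij by (simp add: h_def)
    next
      case 2
      have "i < \<phi> (j - \<phi> 0)"
        using 2 \<phi>(1) by (meson le0 less_le_trans strict_mono_less_eq)
      then show ?thesis using 2 emb_tl bad_gD by (auto simp: h_def)
    next
      case 3
      let ?a = "\<phi> (i - \<phi> 0)" and ?b = "\<phi> (j - \<phi> 0)"
      have "i - \<phi> 0 < j - \<phi> 0" using 3 ij by simp
      then have "R (hd (g ?a)) (hd (g ?b))" "?a < ?b"
        using \<phi> by (auto simp: strict_mono_less)
      then have "\<not> list_emb R (tl (g ?a)) (tl (g ?b))"
        using bad_gD[of ?a ?b] ne by (metis list.collapse list_emb_Cons2)
      then show ?thesis using 3 ij by (simp add: h_def)
    qed
  qed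
  moreover have "h i \<in> lists A" for i
    using bad_g tl_A unfolding h_def bad_def by simp
  ultimately have "bad h" unfolding bad_def by blast
  moreover have "\<forall>i<\<phi> 0. h i = g i" by (simp add: h_def)
  ultimately have "length (g (\<phi> 0)) \<le> length (h (\<phi> 0))" by (rule min)
  then show False using ne[of "\<phi> 0"] by (cases "g (\<phi> 0)") (auto simp: h_def)
qed

text \<open>Variables are treated one at a time: the exponents of one variable have a nondecreasing
  subsequence, and passing to it keeps the monotonicity already obtained for the others.\<close>

lemma dickson:
  fixes S :: "'v set"
  assumes "finite S"
  shows "almost_full_on (\<lambda>s t. \<forall>v. lookup s v \<le> lookup t v) {t :: 'v \<Rightarrow>\<^sub>0 nat. keys t \<subseteq> S}"
proof -
  have nat: "almost_full_on (\<le>) (UNIV :: nat set)"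
    unfolding almost_full_on_def
  proof (intro allI impI, rule ccontr)
    fix f :: "nat \<Rightarrow> nat" assume "\<nexists>i j. i < j \<and> f i \<le> f j"
    then have "\<forall>i. f (Suc i) < f i" by (meson lessI not_le)
    then show False using wf_less wf_iff_no_infinite_down_chain[of less_than] by (auto simp: less_than_iff)
  qed
  have "\<exists>\<phi>::nat \<Rightarrow> nat. strict_mono \<phi> \<and> (\<forall>v\<in>S. \<forall>i j. i < j \<longrightarrow> lookup (f (\<phi> i)) v \<le> lookup (f (\<phi> j)) v)"
    for f :: "nat \<Rightarrow> ('v \<Rightarrow>\<^sub>0 nat)"
    using assms
  proof (induction S rule: finite_induct)
    case empty
    show ?case by (auto intro: exI[of _ id] simp: strict_mono_def)
  next
    case (insert v S)
    then obtain \<phi> :: "nat \<Rightarrow> nat" where \<phi>: "strict_mono \<phi>"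
      "\<forall>v\<in>S. \<forall>i j. i < j \<longrightarrow> lookup (f (\<phi> i)) v \<le> lookup (f (\<phi> j)) v" by blast
    obtain \<psi> :: "nat \<Rightarrow> nat" where \<psi>: "strict_mono \<psi>"
      "\<And>i j. i < j \<Longrightarrow> lookup (f (\<phi> (\<psi> i))) v \<le> lookup (f (\<phi> (\<psi> j))) v"
      using almost_full_on_subseq[OF nat, of "\<lambda>i. lookup (f (\<phi> i)) v"] by auto
    have "strict_mono (\<lambda>i. \<phi> (\<psi> i))"
      using \<phi>(1) \<psi>(1) by (simp add: strict_mono_def)
    then show ?case
      using \<phi>(2) \<psi> by (intro exI[of _ "\<lambda>i. \<phi> (\<psi> i)"]) (auto dest: strict_monoD)
  qed
  note * = this
  show ?thesis
    unfolding almost_full_on_def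
  proof (intro allI impI)
    fix f :: "nat \<Rightarrow> ('v \<Rightarrow>\<^sub>0 nat)" assume f: "\<forall>i. f i \<in> {t. keys t \<subseteq> S}"
    obtain \<phi> :: "nat \<Rightarrow> nat" where \<phi>: "strict_mono \<phi>"
      "\<forall>v\<in>S. \<forall>i j. i < j \<longrightarrow> lookup (f (\<phi> i)) v \<le> lookup (f (\<phi> j)) v"
      using *[of f] by blast
    have "lookup (f (\<phi> 0)) v \<le> lookup (f (\<phi> 1)) v" for v
    proof (cases "v \<in> S")
      case False
      then have "v \<notin> keys (f (\<phi> 0))" using f by blast
      then show ?thesis by (simp add: in_keys_iff)
    qed (use \<phi>(2) in simp)
    then show "\<exists>i j. i < j \<and> (\<forall>v. lookup (f i) v \<le> lookup (f j) v)"
      using \<phi>(1) by (meson strict_monoD zero_less_one)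
  qed
qed

text \<open>Without a bound, for each \<open>C\<close> some word of \<open>S\<close> contains no
  word of \<open>S\<close> of length at most \<open>C\<close>. Along an infinite chain from Higman's
  lemma the first word embeds into words whose \<open>C\<close> exceeds its length, a
  contradiction.\<close>

lemma higman_bound:
  assumes "almost_full_on R A" "\<And>x. x \<in> A \<Longrightarrow> R x x" "S \<subseteq> lists A"
  obtains C where "\<And>w. w \<in> S \<Longrightarrow> \<exists>u\<in>S. length u \<le> C \<and> list_emb R u w"
proof -
  have "\<exists>C. \<forall>w\<in>S. \<exists>u\<in>S. length u \<le> C \<and> list_emb R u w"
  proof (rule ccontr)
    assume "\<not> ?thesis"
    then obtain g where g: "\<And>C. g C \<in> S" "\<And>C u. u \<in> S \<Longrightarrow> length u \<le> C \<Longrightarrow> \<not> list_emb R u (g C)"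
      by metis
    obtain \<phi> :: "nat \<Rightarrow> nat" where \<phi>: "strict_mono \<phi>"
      "\<And>i j. i < j \<Longrightarrow> list_emb R (g (\<phi> i)) (g (\<phi> j))"
      using almost_full_on_subseq[OF higman[OF assms(1)], of g] g(1) assms(3) by blast
    let ?j = "Suc (length (g (\<phi> 0)))"
    have "length (g (\<phi> 0)) \<le> \<phi> ?j"
      using strict_mono_imp_increasing[OF \<phi>(1), of ?j] by simp
    then show False
      using g \<phi>(2)[of 0 ?j] by blast
  qed
  then show thesis using that by blast
qed

subsection \<open>Degrees\<close>

lemma mon_deg_superset:
  assumes "finite A" "keys t \<subseteq> A"
  shows "mon_deg t = (\<Sum>v\<in>A. lookup t v)"
  unfolding mon_deg_def using assms
  by (intro sum.mono_neutral_left) (auto simp: in_keys_iff)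

lemma mon_deg_0 [simp]: "mon_deg 0 = 0"
  and mon_deg_single [simp]: "mon_deg (single v n) = n"
  by (simp_all add: mon_deg_def)

lemma mon_deg_add: "mon_deg (s + t) = mon_deg s + mon_deg t"
proof -
  let ?A = "keys s \<union> keys t"
  have "keys (s + t) \<subseteq> ?A" by (rule keys_add)
  then show ?thesis
    by (simp add: mon_deg_superset[of ?A] lookup_add sum.distrib)
qed

lemma mon_deg_rename [simp]: "mon_deg (rename f t) = mon_deg t"
  by (rule poly_mapping_single_induct[of _ UNIV t]) (auto simp: rename_add mon_deg_add)

section \<open>Homogeneous components and degrees in each copy\<close>

definition restrict_to :: "('a \<Rightarrow> bool) \<Rightarrow> ('a \<Rightarrow>\<^sub>0 'k::comm_ring_1) \<Rightarrow> ('a \<Rightarrow>\<^sub>0 'k)" where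
  "restrict_to P = lin (\<lambda>t. if P t then single t 1 else 0)"

lemma lookup_restrict_to: "lookup (restrict_to P p) t = (if P t then lookup p t else 0)"
proof -
  have "lookup (restrict_to P p) t = (\<Sum>s\<in>keys p. if s = t then (if P t then lookup p t else 0) else 0)"
    unfolding restrict_to_def lin_def lookup_sum
    by (rule sum.cong) (auto simp: lookup_single when_def)
  then show ?thesis by (simp add: not_in_keys_iff_lookup_eq_zero)
qed

lemma hom_part_eq: "hom_part e p = restrict_to (\<lambda>t. mon_deg t = e) p"
proof (rule poly_mapping_eqI)
  fix t
  have "finite {t. (if mon_deg t = e then lookup p t else 0) \<noteq> 0}"
    by (rule finite_subset[OF _ finite_lookup[of p]]) (auto split: if_splits)
  then show "lookup (hom_part e p) t = lookup (restrict_to (\<lambda>t. mon_deg t = e) p) t"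
    by (simp add: hom_part_def lookup_restrict_to)
qed

definition col_deg :: "nat \<Rightarrow> (nat \<times> 'a \<Rightarrow>\<^sub>0 nat) \<Rightarrow> nat" where
  "col_deg i t = mon_deg (Poly_Mapping.map_key (Pair i) t)"

lemma inj_Pair: "inj (Pair i)"
  by (auto simp: inj_on_def)

lemma col_deg_0 [simp]: "col_deg i 0 = 0"
  by (simp add: col_deg_def inj_Pair)

lemma col_deg_add: "col_deg i (s + t) = col_deg i s + col_deg i t"
  by (simp add: col_deg_def map_key_plus inj_Pair mon_deg_add)

lemma col_deg_single [simp]: "col_deg i (single (j, v) n) = (if i = j then n else 0)"
proof -
  have "Poly_Mapping.map_key (Pair i) (single (j, v) n) = (if i = j then single v n else 0)"
    by (rule poly_mapping_eqI)
      (auto simp: Poly_Mapping.map_key.rep_eq inj_Pair lookup_single when_def)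
  then show ?thesis by (simp add: col_deg_def)
qed

lemma col_deg_rename: "col_deg i (rename (\<lambda>v. (j, f v)) t) = (if i = j then mon_deg t else 0)"
  by (rule poly_mapping_single_induct[of _ UNIV t]) (auto simp: rename_add mon_deg_add col_deg_add)

text \<open>The power ideal is generated by copies of the homogeneous ideals \<open>I k\<close>,
  each in the variables of a single copy, hence it contains the components of its elements for the
  multigrading by copies.\<close>

lemma restrict_to_power_ideal:
  assumes "\<And>i. i < m \<Longrightarrow> homogeneous_ideal {..<n i} (I i)"
    and "f \<in> power_ideal r (prod_ideal m n I)"
  shows "restrict_to (\<lambda>t. \<forall>i. col_deg i t = c i) f \<in> power_ideal r (prod_ideal m n I)"
proof -
  let ?J = "power_ideal r (prod_ideal m n I)"
  let ?G = "\<Union>i<r. \<Union>k<m. poly_subst (\<lambda>j. mvar (i, (k, j))) ` I k"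
  have "poly_subst (\<lambda>v. mvar (i, v)) p \<in> ideal_gen ?G" if "p \<in> prod_ideal m n I" "i < r" for i p
    using that(1) unfolding prod_ideal_def
  proof (rule poly_subst_ideal_gen)
    fix g assume "g \<in> (\<Union>k<m. poly_subst (\<lambda>j. mvar (k, j)) ` I k)"
    then obtain k u where g: "k < m" "u \<in> I k" "g = poly_subst (\<lambda>j. mvar (k, j)) u" by blast
    then have "poly_subst (\<lambda>v. mvar (i, v)) g = poly_subst (\<lambda>j. mvar (i, (k, j))) u"
      by (simp add: poly_subst_poly_subst)
    with g(1,2) that(2) show "poly_subst (\<lambda>v. mvar (i, v)) g \<in> ideal_gen ?G"
      by (intro ideal_gen_base) blast
  qed
  then have "?J \<subseteq> ideal_gen ?G"
    unfolding power_ideal_def by (intro ideal_gen_subset) blast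
  with assms(2) have "f \<in> ideal_gen ?G" by blast
  then show ?thesis
  proof (induction rule: ideal_gen_term_induct)
    case (gen t b g)
    then obtain i k u where g: "i < r" "k < m" "u \<in> I k" "g = poly_subst (\<lambda>j. mvar (i, (k, j))) u"
      by blast
    \<comment> \<open>The degree that the generator must contribute in copy \<open>i\<close>. The
      subtraction is truncated, so \<open>Q\<close> records that it is a genuine one and that the
      degrees in the other copies are already right.\<close>
    define e where "e = c i - col_deg i t"
    define Q where "Q \<longleftrightarrow> (\<forall>j. j \<noteq> i \<longrightarrow> col_deg j t = c j) \<and> col_deg i t \<le> c i"
    let ?\<iota> = "rename (\<lambda>j. (i, (k, j)))"
    have Q: "(\<forall>j. col_deg j (t + ?\<iota> s) = c j) \<longleftrightarrow> Q \<and> mon_deg s = e" for s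
    proof -
      have "(\<forall>j. col_deg j (t + ?\<iota> s) = c j)
          \<longleftrightarrow> (\<forall>j. j \<noteq> i \<longrightarrow> col_deg j t = c j) \<and> col_deg i t + mon_deg s = c i"
        by (auto simp: col_deg_add col_deg_rename)
      then show ?thesis unfolding Q_def e_def by auto
    qed
    have "restrict_to (\<lambda>t. \<forall>i. col_deg i t = c i) (single t b * g)
        = lin (\<lambda>s. if Q \<and> mon_deg s = e then single (t + ?\<iota> s) b else 0) u"
      unfolding g(4) poly_subst_rename lin_mult_right restrict_to_def lin_lin
      by (rule lin_cong) (simp add: mult_single Q)
    also have "\<dots> = (if Q then single t b * poly_subst (\<lambda>j. mvar (i, (k, j))) (hom_part e u) else 0)"
      unfolding hom_part_eq poly_subst_rename restrict_to_def lin_mult_right lin_lin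
      by (auto simp: lin_def mult_single intro!: sum.cong)
    finally have *: "restrict_to (\<lambda>t. \<forall>i. col_deg i t = c i) (single t b * g) = \<dots>" .
    have "poly_subst (\<lambda>j. mvar (k, j)) (hom_part e u) \<in> prod_ideal m n I"
      unfolding prod_ideal_def using assms(1)[OF g(2)] g(2,3)
      by (intro ideal_gen_base) (auto simp: homogeneous_ideal_def)
    then have "poly_subst (\<lambda>v. mvar (i, v)) (poly_subst (\<lambda>j. mvar (k, j)) (hom_part e u)) \<in> ?J"
      unfolding power_ideal_def using g(1) by (intro ideal_gen_base) blast
    then show ?case
      unfolding * by (auto simp: poly_subst_poly_subst power_ideal_def intro: ideal_gen_mult)
  qed (auto simp: restrict_to_def lin_add power_ideal_def intro: ideal_gen_add)
qed

subsection \<open>Noncommutative lifts\<close>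

text \<open>
  A form of degree \<open>e\<close> in the coordinates \<open>z\<^sub>\<mu>\<close>, \<open>\<mu> \<in> D\<close>, is lifted to a tensor, that is, to a linear
  combination of words of length \<open>e\<close> over \<open>D\<close>. A word is coloured by a list of indices of copies;
  \<open>evaluate \<tau>\<close> substitutes the \<open>\<tau> ! j\<close>-th copy of the variables into the \<open>j\<close>-th tensor factor.
\<close>

type_synonym 'v word = "('v \<Rightarrow>\<^sub>0 nat) list"

definition words :: "nat \<Rightarrow> 'a set \<Rightarrow> 'a list set" where
  "words e D = {w. length w = e \<and> set w \<subseteq> D}"

definition col_mon :: "nat list \<Rightarrow> 'v word \<Rightarrow> (nat \<times> 'v \<Rightarrow>\<^sub>0 nat)" where
  "col_mon \<tau> w = (\<Sum>(i, \<mu>)\<leftarrow>zip \<tau> w. rename (Pair i) \<mu>)"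

definition evaluate :: "nat list \<Rightarrow> ('v word \<Rightarrow>\<^sub>0 'k::comm_ring_1) \<Rightarrow> (nat \<times> 'v, 'k) mpoly" where
  "evaluate \<tau> = lin (\<lambda>w. single (col_mon \<tau> w) 1)"

definition word_mon :: "'a list \<Rightarrow> ('a \<Rightarrow>\<^sub>0 nat)" where
  "word_mon w = (\<Sum>a\<leftarrow>w. single a 1)"

definition symmetrize :: "('a list \<Rightarrow>\<^sub>0 'k::comm_ring_1) \<Rightarrow> ('a, 'k) mpoly" where
  "symmetrize = lin (\<lambda>w. single (word_mon w) 1)"

text \<open>The condition is imposed for each colouring separately, not only on the sum over all of
  them, and asks for no symmetry of \<open>F\<close>; in this form it survives the insertion of a
  letter at a fixed position.\<close>

definition vanishing :: "nat \<Rightarrow> (nat \<times> 'v, 'k::comm_ring_1) mpoly set \<Rightarrow> nat \<Rightarrow> ('v \<Rightarrow>\<^sub>0 nat) set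
    \<Rightarrow> ('v word \<Rightarrow>\<^sub>0 'k) set" where
  "vanishing r J e D = {F. keys F \<subseteq> words e D \<and> (\<forall>\<tau>\<in>words e {..<r}. evaluate \<tau> F \<in> J)}"

lemma words_0: "words 0 D = {[]}"
  by (auto simp: words_def)

lemma words_Suc: "words (Suc e) D = (\<lambda>(a, w). a # w) ` (D \<times> words e D)"
  by (auto simp: words_def length_Suc_conv image_iff)

lemma finite_words: "finite D \<Longrightarrow> finite (words e D)"
  unfolding words_def using finite_lists_length_eq[of D e] by (simp add: conj_commute)

lemma subst_mon_word_mon: "subst_mon \<sigma> (word_mon w) = prod_list (map \<sigma> w)"
  by (induction w) (auto simp: word_mon_def subst_mon_add)

text \<open>Expanding a product of sums over copies means choosing a copy for every factor, that is,
  a colouring.\<close>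

lemma prod_list_sum_copies:
  "prod_list (map (sum_copies r) w) = (\<Sum>\<tau>\<in>words (length w) {..<r}. single (col_mon \<tau> w) (1::'k::comm_ring_1))"
proof (induction w)
  case (Cons \<mu> w)
  have "inj_on (\<lambda>(a, w). a # w) ({..<r} \<times> words (length w) {..<r})"
    by (auto simp: inj_on_def)
  note inj = this
  have "prod_list (map (sum_copies r) (\<mu> # w))
      = sum_copies r \<mu> * (\<Sum>\<tau>\<in>words (length w) {..<r}. single (col_mon \<tau> w) (1::'k))"
    by (simp add: Cons.IH)
  also have "\<dots> = (\<Sum>(i, \<tau>)\<in>{..<r} \<times> words (length w) {..<r}.
      single (rename (Pair i) \<mu> + col_mon \<tau> w) 1)"
    by (simp add: sum_copies_def sum_product sum.cartesian_product mult_single)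
  also have "\<dots> = (\<Sum>\<tau>\<in>(\<lambda>(a, w). a # w) ` ({..<r} \<times> words (length w) {..<r}).
      single (col_mon \<tau> (\<mu> # w)) 1)"
    by (subst sum.reindex[OF inj]) (auto simp: col_mon_def intro!: sum.cong)
  finally show ?case
    by (simp add: words_Suc)
qed (simp add: words_0 col_mon_def)

lemma poly_subst_symmetrize:
  "poly_subst (sum_copies r) (symmetrize F)
    = lin (\<lambda>w. \<Sum>\<tau>\<in>words (length w) {..<r}. single (col_mon \<tau> w) 1) F"
  unfolding symmetrize_def poly_subst_lin lin_lin
  by (rule lin_cong) (simp add: subst_mon_word_mon prod_list_sum_copies)

lemma keys_word_mon: "keys (word_mon w) = set w"
proof (induction w)
  case (Cons a w)
  have "word_mon (a # w) = single a 1 + word_mon w"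
    by (simp add: word_mon_def)
  moreover have "keys (single a (1::nat) + word_mon w) = insert a (keys (word_mon w))"
    by (auto simp: in_keys_iff lookup_add lookup_single when_def split: if_splits)
  ultimately show ?case
    using Cons by simp
qed (simp add: word_mon_def)

lemma mon_deg_word_mon: "mon_deg (word_mon w) = length w"
  by (induction w) (auto simp: word_mon_def mon_deg_add)

text \<open>The pullback of the symmetrization is the sum of the evaluations over all colourings,
  each of which lies in the ideal.\<close>

lemma symmetrize_vanishing:
  assumes "F \<in> vanishing r (ideal_gen G) e D"
  shows "symmetrize F \<in> poly_in D" "poly_subst (sum_copies r) (symmetrize F) \<in> ideal_gen G"
    "total_deg (symmetrize F) \<le> e"
proof -
  have F: "w \<in> words e D" if "w \<in> keys F" for w
    using assms that by (auto simp: vanishing_def)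
  have "keys (symmetrize F) \<subseteq> word_mon ` keys F"
    unfolding symmetrize_def using keys_lin[of "\<lambda>w. single (word_mon w) 1" F] by auto
  then have *: "mon_deg t = e \<and> keys t \<subseteq> D" if "t \<in> keys (symmetrize F)" for t
    using that F by (force simp: words_def keys_word_mon mon_deg_word_mon)
  then show "symmetrize F \<in> poly_in D" "total_deg (symmetrize F) \<le> e"
    by (auto simp: poly_in_def total_deg_def)
  have "poly_subst (sum_copies r) (symmetrize F) = (\<Sum>\<tau>\<in>words e {..<r}. evaluate \<tau> F)"
    unfolding poly_subst_symmetrize evaluate_def lin_sum_fun[symmetric]
    by (rule lin_cong) (use F in \<open>auto simp: words_def\<close>)
  also have "\<dots> \<in> ideal_gen G"
    using assms by (intro ideal_gen_sum) (auto simp: vanishing_def)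
  finally show "poly_subst (sum_copies r) (symmetrize F) \<in> ideal_gen G" .
qed

section \<open>Symmetric lifts in characteristic 0\<close>

lemma finite_word_fiber: "finite {w. word_mon w = t}"
proof (rule finite_subset)
  show "{w. word_mon w = t} \<subseteq> words (mon_deg t) (keys t)"
    by (auto simp: words_def mon_deg_word_mon keys_word_mon)
qed (simp add: finite_words)

lemma word_fiber_nonempty: "\<exists>w. word_mon w = t"
proof (rule poly_mapping_single_induct[of _ UNIV t])
  have "word_mon (w @ replicate n v) = word_mon w + single v n" for w v n
    by (induction n) (auto simp: word_mon_def add_ac simp flip: single_add)
  then show "\<exists>w. word_mon w = p + single v n" if "\<exists>w. word_mon w = p" for p v n
    using that by metis
  show "\<exists>w. word_mon w = 0"
    by (auto simp: word_mon_def intro: exI[of _ "[]"])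
qed auto

text \<open>A section of \<open>symmetrize\<close>: each monomial is spread evenly over the words
  with that commutative image. The coefficients are thus invariant under rearrangement, and the
  division uses characteristic 0.\<close>

definition sym_lift :: "('a, 'k::field_char_0) mpoly \<Rightarrow> ('a list \<Rightarrow>\<^sub>0 'k)" where
  "sym_lift = lin (\<lambda>t. smul (1 / of_nat (card {w. word_mon w = t})) (\<Sum>w | word_mon w = t. single w 1))"

lemma symmetrize_sym_lift: "symmetrize (sym_lift f) = f"
proof -
  have "smul (1 / of_nat (card {w. word_mon w = t})) (\<Sum>w | word_mon w = t. single (word_mon w) 1)
      = single t (1 :: 'k::field_char_0)" for t :: "'a \<Rightarrow>\<^sub>0 nat"
  proof -
    have "card {w. word_mon w = t} \<noteq> 0"
      using finite_word_fiber[of t] word_fiber_nonempty[of t] by auto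
    moreover have "(\<Sum>w | word_mon w = t. single (word_mon w) 1)
        = (\<Sum>w | word_mon w = t. single t (1 :: 'k))"
      by (rule sum.cong) auto
    ultimately show ?thesis
      by (simp flip: single_of_nat add: of_nat_single mult_single)
  qed
  then have "symmetrize (sym_lift f) = lin (\<lambda>t. single t 1) f"
    unfolding symmetrize_def sym_lift_def lin_lin
    by (intro lin_cong) (simp only: lin_smul lin_sum lin_single smul_simps(2))
  then show ?thesis by simp
qed

lemma lookup_sym_lift:
  "lookup (sym_lift f) w = lookup f (word_mon w) / of_nat (card {u. word_mon u = word_mon w})"
proof -
  have *: "lookup (\<Sum>u | word_mon u = t. single u (1::'a)) w = (if word_mon w = t then 1 else 0)" for t
  proof -
    have "lookup (\<Sum>u | word_mon u = t. single u (1::'a)) w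
        = (\<Sum>u | word_mon u = t. if u = w then 1 else 0)"
      unfolding lookup_sum by (rule sum.cong) (auto simp: lookup_single when_def)
    then show ?thesis using finite_word_fiber[of t] by simp
  qed
  have "lookup (sym_lift f) w = (\<Sum>t\<in>keys f. if t = word_mon w
      then lookup f (word_mon w) / of_nat (card {u. word_mon u = word_mon w}) else 0)"
    unfolding sym_lift_def lin_def lookup_sum by (rule sum.cong) (auto simp: *)
  then show ?thesis by (simp add: not_in_keys_iff_lookup_eq_zero)
qed

lemma word_mon_mset: "mset u = mset w \<Longrightarrow> word_mon u = word_mon w"
  by (simp only: word_mon_def sum_mset_sum_list[symmetric] mset_map)

text \<open>A permutation of positions carrying \<open>\<tau>'\<close> to \<open>\<tau>\<close>
  permutes the support of \<open>F\<close>, preserves its coefficients and matches the coloured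
  monomials, so it only reindexes the sum.\<close>

lemma evaluate_mset:
  assumes "keys F \<subseteq> {w. length w = e}" "\<And>u w. mset u = mset w \<Longrightarrow> lookup F u = lookup F w"
    and "mset \<tau> = mset \<tau>'" "length \<tau>' = e"
  shows "evaluate \<tau> F = evaluate \<tau>' F"
proof -
  obtain p where p: "p permutes {..<e}" "permute_list p \<tau>' = \<tau>"
    using mset_eq_permutation[OF assms(3)] assms(4) by metis
  have into: "permute_list p w \<in> keys F" if "w \<in> keys F" for w
    using assms(1,2) that p(1) by (metis (mono_tags) in_keys_iff mem_Collect_eq mset_permute_list subsetD)
  have "inj_on (permute_list p) (keys F)"
  proof (rule inj_on_inverseI)
    fix w assume "w \<in> keys F"
    then have "length w = e" using assms(1) by blast
    then show "permute_list (inv p) (permute_list p w) = w"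
      using p(1) permute_list_compose[of "inv p" w p] by (simp add: permutes_inv permutes_inv_o)
  qed
  then have bij: "bij_betw (permute_list p) (keys F) (keys F)"
    using into by (intro bij_betw_imageI endo_inj_surj) auto
  have col: "col_mon \<tau> (permute_list p w) = col_mon \<tau>' w" if "w \<in> keys F" for w
  proof -
    have len: "length w = e" using assms(1) that by blast
    then have "zip \<tau> (permute_list p w) = permute_list p (zip \<tau>' w)"
      using p assms(4) by (simp flip: p(2) add: permute_list_zip[of p "{..<e}"])
    then have "mset (zip \<tau> (permute_list p w)) = mset (zip \<tau>' w)"
      using p(1) assms(4) len by simp
    then show ?thesis
      by (simp only: col_mon_def sum_mset_sum_list[symmetric] mset_map)
  qed
  have "evaluate \<tau> F
      = (\<Sum>w\<in>keys F. smul (lookup F (permute_list p w)) (single (col_mon \<tau> (permute_list p w)) 1))"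
    unfolding evaluate_def lin_def by (rule sum.reindex_bij_betw[OF bij, symmetric])
  also have "\<dots> = evaluate \<tau>' F"
    unfolding evaluate_def lin_def
  proof (rule sum.cong)
    fix w assume w: "w \<in> keys F"
    then have "length w = e" using assms(1) by blast
    then have "lookup F (permute_list p w) = lookup F w"
      using p(1) by (intro assms(2)) simp
    then show "smul (lookup F (permute_list p w)) (single (col_mon \<tau> (permute_list p w)) 1)
        = smul (lookup F w) (single (col_mon \<tau>' w) 1)"
      using col[OF w] by simp
  qed simp
  finally show ?thesis .
qed

lemma col_deg_col_mon:
  assumes "length \<tau> = length w" "\<And>\<mu>. \<mu> \<in> set w \<Longrightarrow> mon_deg \<mu> = \<delta>"
  shows "col_deg i (col_mon \<tau> w) = \<delta> * count (mset \<tau>) i"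
  using assms
proof (induction \<tau> w rule: list_induct2)
  case (Cons j \<tau> \<mu> w)
  have "col_mon (j # \<tau>) (\<mu> # w) = rename (Pair j) \<mu> + col_mon \<tau> w"
    by (simp add: col_mon_def)
  then show ?case
    using Cons col_deg_rename[of i j "\<lambda>v. v" \<mu>] by (simp add: col_deg_add)
qed (simp add: col_mon_def)

text \<open>
  If all letters have degree \<open>\<delta> \<ge> 1\<close>, then a colouring is determined up to permutation by the
  multidegree of the evaluated word, so the evaluations are multiples of multihomogeneous components.
\<close>

lemma sym_lift_vanishing:
  fixes f :: "('v \<Rightarrow>\<^sub>0 nat, 'k::field_char_0) mpoly"
  assumes f: "f \<in> poly_in D" "poly_subst (sum_copies r) f \<in> ideal_gen G"
    and \<delta>: "\<delta> \<ge> 1" "\<And>\<mu>. \<mu> \<in> D \<Longrightarrow> mon_deg \<mu> = \<delta>"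
    and hom: "\<And>g c. g \<in> ideal_gen G \<Longrightarrow> restrict_to (\<lambda>t. \<forall>i. col_deg i t = c i) g \<in> ideal_gen G"
  shows "restrict_to (\<lambda>w. length w = e) (sym_lift f) \<in> vanishing r (ideal_gen G) e D"
proof -
  let ?F = "sym_lift f"
  let ?Fe = "restrict_to (\<lambda>w. length w = e) ?F"
  have F: "set w \<subseteq> D" if "w \<in> keys ?F" for w
  proof -
    have "word_mon w \<in> keys f"
      using that by (auto simp: in_keys_iff lookup_sym_lift)
    then have "keys (word_mon w) \<subseteq> D"
      using f(1) unfolding poly_in_def by blast
    then show ?thesis by (simp add: keys_word_mon)
  qed
  have Fe: "keys ?Fe = {w \<in> keys ?F. length w = e}"
    by (auto simp: in_keys_iff lookup_restrict_to split: if_splits)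
  have "evaluate \<tau>0 ?Fe \<in> ideal_gen G" if \<tau>0: "\<tau>0 \<in> words e {..<r}" for \<tau>0
  proof -
    let ?T = "{\<tau>. mset \<tau> = mset \<tau>0}"
    let ?P = "\<lambda>t. \<forall>i. col_deg i t = \<delta> * count (mset \<tau>0) i"
    have T: "?T \<subseteq> words e {..<r}"
      using \<tau>0 by (auto simp: words_def dest: mset_eq_length mset_eq_setD)
    then have fin: "finite ?T"
      by (rule finite_subset) (simp add: finite_words)
    have "\<tau>0 \<in> ?T" by simp
    with fin have card: "card ?T \<noteq> 0" by auto
    have len: "length w = e" if "\<tau> \<in> words (length w) {..<r}" "mset \<tau> = mset \<tau>0" for \<tau> and w :: "'v word"
      using that \<tau>0 by (auto simp: words_def dest: mset_eq_length)
    \<comment> \<open>This component collects exactly the colourings in \<open>?T\<close>. By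
      symmetry of the lift they all evaluate to the same polynomial, so the component is
      \<open>card ?T\<close> times a single evaluation, and dividing by this number gives the
      claim.\<close>
    have "restrict_to ?P (poly_subst (sum_copies r) f)
        = lin (\<lambda>w. \<Sum>\<tau>\<in>words (length w) {..<r}. if ?P (col_mon \<tau> w) then single (col_mon \<tau> w) 1 else 0) ?F"
      by (subst symmetrize_sym_lift[of f, symmetric])
        (simp add: poly_subst_symmetrize restrict_to_def lin_lin lin_sum if_distrib cong: if_cong)
    also have "\<dots> = lin (\<lambda>w. \<Sum>\<tau>\<in>?T. if length w = e then single (col_mon \<tau> w) 1 else 0) ?F"
    proof (rule lin_cong)
      fix w assume w: "w \<in> keys ?F"
      have P: "?P (col_mon \<tau> w) \<longleftrightarrow> mset \<tau> = mset \<tau>0" if "\<tau> \<in> words (length w) {..<r}" for \<tau>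
      proof -
        have "col_deg i (col_mon \<tau> w) = \<delta> * count (mset \<tau>) i" for i
          using that F[OF w] \<delta>(2) by (intro col_deg_col_mon) (auto simp: words_def)
        then show ?thesis using \<delta>(1) by (simp add: multiset_eq_iff)
      qed
      have "(\<Sum>\<tau>\<in>words (length w) {..<r}. if ?P (col_mon \<tau> w) then single (col_mon \<tau> w) (1::'k) else 0)
          = (\<Sum>\<tau>\<in>words (length w) {..<r}. if mset \<tau> = mset \<tau>0 then single (col_mon \<tau> w) 1 else 0)"
        by (rule sum.cong) (simp_all only: P)
      also have "\<dots> = (\<Sum>\<tau>\<in>words (length w) {..<r} \<inter> ?T. single (col_mon \<tau> w) 1)"
        by (simp add: sum.inter_restrict finite_words)
      also have "\<dots> = (\<Sum>\<tau>\<in>?T. if length w = e then single (col_mon \<tau> w) 1 else 0)"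
      proof (cases "length w = e")
        case True
        then show ?thesis using T by (simp add: Int_absorb1)
      next
        case False
        then have "words (length w) {..<r} \<inter> ?T = {}" using len by blast
        then show ?thesis using False by (simp only: sum.empty) simp
      qed
      finally show "(\<Sum>\<tau>\<in>words (length w) {..<r}. if ?P (col_mon \<tau> w) then single (col_mon \<tau> w) (1::'k) else 0)
          = (\<Sum>\<tau>\<in>?T. if length w = e then single (col_mon \<tau> w) 1 else 0)" .
    qed
    also have "\<dots> = (\<Sum>\<tau>\<in>?T. evaluate \<tau> ?Fe)"
      unfolding lin_sum_fun evaluate_def restrict_to_def lin_lin
      by (intro sum.cong lin_cong) auto
    also have "\<dots> = (\<Sum>\<tau>\<in>?T. evaluate \<tau>0 ?Fe)"
    proof (rule sum.cong)
      fix \<tau> assume \<tau>: "\<tau> \<in> ?T"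
      have sym: "lookup ?Fe u = lookup ?Fe w" if "mset u = mset w" for u w
        using word_mon_mset[OF that] mset_eq_length[OF that] by (simp add: lookup_restrict_to lookup_sym_lift)
      have "keys ?Fe \<subseteq> {w. length w = e}"
        using Fe by blast
      then show "evaluate \<tau> ?Fe = evaluate \<tau>0 ?Fe"
      proof (rule evaluate_mset[OF _ sym])
        show "mset \<tau> = mset \<tau>0" "length \<tau>0 = e"
          using \<tau> \<tau>0 by (auto simp: words_def)
      qed
    qed simp
    also have "\<dots> = smul (of_nat (card ?T)) (evaluate \<tau>0 ?Fe)"
      using smul_sum_left[of "\<lambda>_. 1" ?T "evaluate \<tau>0 ?Fe"] by simp
    finally have eq: "restrict_to ?P (poly_subst (sum_copies r) f) = smul (of_nat (card ?T)) (evaluate \<tau>0 ?Fe)" .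
    have "smul (of_nat (card ?T)) (evaluate \<tau>0 ?Fe) \<in> ideal_gen G"
      using hom[OF f(2), of "\<lambda>i. \<delta> * count (mset \<tau>0) i"] by (simp only: eq)
    then have "smul (1 / of_nat (card ?T)) (smul (of_nat (card ?T)) (evaluate \<tau>0 ?Fe)) \<in> ideal_gen G"
      by (rule ideal_gen_smul)
    moreover have "(1 / of_nat (card ?T)) * of_nat (card ?T) = (1 :: 'k)"
      using card by simp
    ultimately show ?thesis by (simp only: smul_simps)
  qed
  with F Fe show ?thesis by (auto simp: vanishing_def words_def)
qed

subsection \<open>Leading words\<close>

text \<open>A relation rather than a function, since 0 has no leading word. Words are compared
  lexicographically, with letters ordered compatibly with addition of exponents.\<close>

definition leading :: "('a \<Rightarrow>\<^sub>0 'k::zero) \<Rightarrow> 'a::linorder \<Rightarrow> bool" where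
  "leading F w \<longleftrightarrow> w \<in> keys F \<and> (\<forall>u\<in>keys F. u \<le> w)"

lemma lookup_lin_inj_on:
  assumes "inj_on h W" "keys F \<subseteq> W" "u \<in> W"
  shows "lookup (lin (\<lambda>w. single (h w) 1) F) (h u) = lookup F u"
proof -
  have "lookup (lin (\<lambda>w. single (h w) 1) F) (h u) = (\<Sum>w\<in>keys F. if w = u then lookup F u else 0)"
    unfolding lin_def lookup_sum
    by (rule sum.cong) (use assms in \<open>auto simp: lookup_single when_def inj_on_def\<close>)
  then show ?thesis by (simp add: not_in_keys_iff_lookup_eq_zero)
qed

text \<open>A strictly monotone relabelling neither merges nor reorders words, so no cancellation
  occurs and the largest word stays largest.\<close>

lemma leading_lin_strict_mono:
  assumes "leading F w" "keys F \<subseteq> W" "strict_mono_on W h"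
  shows "leading (lin (\<lambda>w. single (h w) (1::'k::comm_ring_1)) F) (h w)"
  unfolding leading_def
proof (intro conjI ballI)
  have w: "w \<in> keys F" "w \<in> W" using assms by (auto simp: leading_def)
  then show "h w \<in> keys (lin (\<lambda>w. single (h w) (1::'k)) F)"
    using lookup_lin_inj_on[OF strict_mono_on_imp_inj_on[OF assms(3)] assms(2) w(2)]
    by (simp add: in_keys_iff)
  fix u assume "u \<in> keys (lin (\<lambda>w. single (h w) (1::'k)) F)"
  then obtain v where v: "v \<in> keys F" "u = h v"
    using keys_lin[of "\<lambda>w. single (h w) (1::'k)" F] by auto
  then have "v \<le> w" "v \<in> W" using assms by (auto simp: leading_def)
  then show "u \<le> h w"
    using v w assms(3) strict_mono_onD[of W h v w] by (cases "v = w") (auto intro: less_imp_le)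
qed

lemma leading_exists: "F \<noteq> 0 \<Longrightarrow> \<exists>w. leading F w"
  unfolding leading_def using Max_in[of "keys F"] Max_ge[of "keys F"] by (intro exI[of _ "Max (keys F)"]) auto

lemma vanishing_smul: "F \<in> vanishing r (ideal_gen G) e D \<Longrightarrow> smul c F \<in> vanishing r (ideal_gen G) e D"
  unfolding vanishing_def evaluate_def mem_Collect_eq lin_smul
  by (intro conjI subsetI ballI ideal_gen_smul) (auto simp: in_keys_iff subset_iff, metis mult_zero_right)

lemma vanishing_diff:
  assumes "F \<in> vanishing r (ideal_gen G) e D" "F' \<in> vanishing r (ideal_gen G) e D"
  shows "F - F' \<in> vanishing r (ideal_gen G) e D"
  using assms keys_diff[of F F']
  by (auto simp: vanishing_def evaluate_def lin_diff intro: ideal_gen_diff)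

subsubsection \<open>Multiplication by words\<close>

text \<open>At the first position where two words of equal length differ, the same letter of
  \<open>q\<close> is added to both, which keeps the strict inequality.\<close>

lemma strict_mono_on_map2_plus:
  "strict_mono_on {w. length w = length q} (map2 (+) (q :: ('v::linorder) word))"
proof -
  have "map2 (+) q u < map2 (+) q w" if "length u = length q" "length w = length q" "u < w" for u w
  proof -
    have "length q = length u" "length u = length w" using that by auto
    then show ?thesis using that(3)
      by (induction q u w rule: list_induct3) (auto intro: add_strict_left_mono)
  qed
  then show ?thesis by (auto simp: strict_mono_on_def)
qed

lemma col_mon_map2_plus:
  assumes "length \<tau> = length q" "length q = length w"
  shows "col_mon \<tau> (map2 (+) q w) = col_mon \<tau> q + col_mon \<tau> w"
  using assms
  by (induction \<tau> q w rule: list_induct3) (auto simp: col_mon_def rename_add add_ac)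

text \<open>Multiplication by \<open>q\<close> multiplies the evaluation at \<open>\<tau>\<close> by
  the monomial \<open>col_mon \<tau> q\<close>. This is the operation that changes the multidegree
  of the letters.\<close>

lemma vanishing_mult_word:
  fixes q :: "('v::linorder) word"
  assumes "F \<in> vanishing r (ideal_gen G) e D" "leading F w" "length q = e"
    and D: "\<And>u. u \<in> words e D \<Longrightarrow> map2 (+) q u \<in> words e D'"
  shows "lin (\<lambda>u. single (map2 (+) q u) 1) F \<in> vanishing r (ideal_gen G) e D'"
    and "leading (lin (\<lambda>u. single (map2 (+) q u) 1) F) (map2 (+) q w)"
proof -
  let ?F = "lin (\<lambda>u. single (map2 (+) q u) 1) F"
  have F: "keys F \<subseteq> words e D"
    using assms(1) by (simp add: vanishing_def)
  have "keys ?F \<subseteq> words e D'"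
    using keys_lin[of "\<lambda>u. single (map2 (+) q u) 1" F] F D by auto
  moreover have "evaluate \<tau> ?F \<in> ideal_gen G" if "\<tau> \<in> words e {..<r}" for \<tau>
  proof -
    have "evaluate \<tau> ?F = single (col_mon \<tau> q) 1 * evaluate \<tau> F"
      unfolding evaluate_def lin_lin lin_mult_right
    proof (rule lin_cong)
      fix u assume "u \<in> keys F"
      then show "lin (\<lambda>w. single (col_mon \<tau> w) 1) (single (map2 (+) q u) 1)
          = single (col_mon \<tau> q) 1 * single (col_mon \<tau> u) 1"
        using that F assms(3) by (auto simp: mult_single words_def col_mon_map2_plus)
    qed
    also have "\<dots> \<in> ideal_gen G"
      using assms(1) that by (intro ideal_gen_mult) (simp add: vanishing_def)
    finally show ?thesis .
  qed
  ultimately show "?F \<in> vanishing r (ideal_gen G) e D'"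
    by (simp add: vanishing_def)
  show "leading ?F (map2 (+) q w)"
    by (rule leading_lin_strict_mono[OF assms(2) _ strict_mono_on_map2_plus])
      (use F assms(3) in \<open>auto simp: words_def\<close>)
qed

subsubsection \<open>Insertion of letters\<close>

definition insert_at :: "nat \<Rightarrow> 'a \<Rightarrow> 'a list \<Rightarrow> 'a list" where
  "insert_at p a w = take p w @ a # drop p w"

lemma length_insert_at [simp]: "length (insert_at p a w) = Suc (length w)"
  by (simp add: insert_at_def)

lemma set_insert_at: "set (insert_at p a w) = insert a (set w)"
  by (metis append_take_drop_id insert_at_def list.set(2) set_append Un_insert_right)

lemma word_mon_insert_at: "word_mon (insert_at p a w) = single a 1 + word_mon w"
proof -
  have "mset (insert_at p a w) = mset (a # w)"
    by (metis append_take_drop_id insert_at_def mset.simps(2) mset_append union_mset_add_mset_right)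
  from word_mon_mset[OF this] show ?thesis
    by (simp add: word_mon_def)
qed

lemma insert_at_Cons: "insert_at (Suc p) a (b # w) = b # insert_at p a w"
  by (simp add: insert_at_def)

text \<open>Both words receive the same letter at the same place, so their first difference still
  decides the comparison.\<close>

lemma strict_mono_on_insert_at: "strict_mono_on {w. length w = e} (insert_at p (a::'a::linorder))"
proof -
  have "insert_at p a u < insert_at p a w" if "length u = length w" "u < w" for u w
    using that
  proof (induction u w arbitrary: p rule: list_induct2)
    case (Cons x u y w)
    show ?case
    proof (cases p)
      case 0
      then show ?thesis using Cons.prems by (simp add: insert_at_def)
    next
      case (Suc p')
      then show ?thesis using Cons.prems Cons.IH by (auto simp: insert_at_Cons)
    qed
  qed simp
  then show ?thesis by (auto simp: strict_mono_on_def)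
qed

lemma col_mon_insert_at:
  assumes "length \<tau> = Suc (length w)" "p \<le> length w"
  shows "col_mon \<tau> (insert_at p \<mu> w)
    = rename (Pair (\<tau> ! p)) \<mu> + col_mon (take p \<tau> @ drop (Suc p) \<tau>) w"
proof -
  have "\<tau> = take p \<tau> @ \<tau> ! p # drop (Suc p) \<tau>"
    using assms by (simp add: id_take_nth_drop)
  then have "col_mon \<tau> (insert_at p \<mu> w) = col_mon (take p \<tau> @ \<tau> ! p # drop (Suc p) \<tau>) (take p w @ \<mu> # drop p w)"
    by (simp add: insert_at_def)
  also have "\<dots> = rename (Pair (\<tau> ! p)) \<mu> + col_mon (take p \<tau> @ drop (Suc p) \<tau>) (take p w @ drop p w)"
    using assms by (simp add: col_mon_def add_ac del: append_take_drop_id)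
  finally show ?thesis by simp
qed

text \<open>The evaluation at \<open>\<tau>\<close> becomes a monomial times the evaluation of
  \<open>F\<close> at \<open>\<tau>\<close> with its \<open>p\<close>-th colour deleted. The
  position of the new letter disappears under symmetrization, leaving multiplication by one
  coordinate.\<close>

lemma vanishing_insert_at:
  fixes \<mu> :: "'v::linorder \<Rightarrow>\<^sub>0 nat" and F :: "'v word \<Rightarrow>\<^sub>0 'k::comm_ring_1"
  assumes "F \<in> vanishing r (ideal_gen G) e D" "leading F w" "\<mu> \<in> D" "p \<le> e"
  defines "F' \<equiv> lin (\<lambda>u. single (insert_at p \<mu> u) 1) F"
  shows "F' \<in> vanishing r (ideal_gen G) (Suc e) D" "leading F' (insert_at p \<mu> w)"
    "symmetrize F' = mvar \<mu> * symmetrize F"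
proof -
  have F: "keys F \<subseteq> words e D"
    using assms(1) by (simp add: vanishing_def)
  have "keys F' \<subseteq> words (Suc e) D"
    using keys_lin[of "\<lambda>u. single (insert_at p \<mu> u) (1::'k)" F] F assms(3)
    by (force simp: F'_def words_def set_insert_at)
  moreover have "evaluate \<tau> F' \<in> ideal_gen G" if \<tau>: "\<tau> \<in> words (Suc e) {..<r}" for \<tau>
  proof -
    let ?\<tau> = "take p \<tau> @ drop (Suc p) \<tau>"
    have "evaluate \<tau> F' = single (rename (Pair (\<tau> ! p)) \<mu>) 1 * evaluate ?\<tau> F"
      unfolding evaluate_def F'_def lin_lin lin_mult_right
    proof (rule lin_cong)
      fix u assume "u \<in> keys F"
      then have "length u = e" using F by (auto simp: words_def)
      then show "lin (\<lambda>w. single (col_mon \<tau> w) 1) (single (insert_at p \<mu> u) 1)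
          = single (rename (Pair (\<tau> ! p)) \<mu>) (1::'k) * single (col_mon ?\<tau> u) 1"
        using \<tau> assms(4) by (simp add: mult_single words_def col_mon_insert_at)
    qed
    moreover have "?\<tau> \<in> words e {..<r}"
      using \<tau> assms(4) set_take_subset[of p \<tau>] set_drop_subset[of "Suc p" \<tau>] by (auto simp: words_def)
    ultimately show ?thesis
      using assms(1) by (auto simp: vanishing_def intro: ideal_gen_mult)
  qed
  ultimately show "F' \<in> vanishing r (ideal_gen G) (Suc e) D"
    by (simp add: vanishing_def)
  show "leading F' (insert_at p \<mu> w)"
    unfolding F'_def by (rule leading_lin_strict_mono[OF assms(2) _ strict_mono_on_insert_at[of e]])
      (use F in \<open>auto simp: words_def\<close>)
  show "symmetrize F' = mvar \<mu> * symmetrize F"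
    unfolding symmetrize_def F'_def lin_lin lin_mult_right
    by (rule lin_cong) (simp add: word_mon_insert_at mvar_def mult_single)
qed

lemma subseq_insert_at:
  assumes "subseq x w" "x \<noteq> w"
  obtains p a w' where "w = insert_at p a w'" "p \<le> length w'" "subseq x w'"
proof -
  have "\<exists>p a w'. w = insert_at p a w' \<and> p \<le> length w' \<and> subseq x w'"
    using assms
  proof (induction rule: list_emb.induct)
    case (list_emb_Nil w)
    then obtain a w' where "w = a # w'" by (cases w) auto
    then show ?case by (intro exI[of _ 0]) (auto simp: insert_at_def)
  next
    case (list_emb_Cons x w a)
    then show ?case by (intro exI[of _ 0] exI[of _ a] exI[of _ w]) (auto simp: insert_at_def)
  next
    case (list_emb_Cons2 a b x w)
    then obtain p c w' where "w = insert_at p c w'" "p \<le> length w'" "subseq x w'" by auto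
    with list_emb_Cons2(1) show ?case
      by (intro exI[of _ "Suc p"] exI[of _ c] exI[of _ "b # w'"]) (auto simp: insert_at_Cons)
  qed
  then show thesis using that by blast
qed

text \<open>The missing letters are inserted one by one. The last insertion exhibits the
  symmetrization as a coordinate times a symmetrization from length one less.\<close>

lemma vanishing_subseq:
  fixes F :: "('v::linorder) word \<Rightarrow>\<^sub>0 'k::comm_ring_1"
  assumes "F \<in> vanishing r (ideal_gen G) (length x) D" "leading F x" "subseq x w" "set w \<subseteq> D"
  obtains F' where "F' \<in> vanishing r (ideal_gen G) (length w) D" "leading F' w"
    "length x < length w \<Longrightarrow>
      symmetrize F' \<in> ideal_gen (symmetrize ` vanishing r (ideal_gen G) (length w - 1) D)"
proof -
  have "\<exists>F'. F' \<in> vanishing r (ideal_gen G) (length w) D \<and> leading F' w \<and> (length x < length w \<longrightarrow>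
      symmetrize F' \<in> ideal_gen (symmetrize ` vanishing r (ideal_gen G) (length w - 1) D))"
    using assms(3,4)
  proof (induction "length w" arbitrary: w)
    case 0
    then have "subseq x []" by simp
    from list_emb_Nil2[OF this] 0 have "w = x" by simp
    then show ?case using assms(1,2) by auto
  next
    case (Suc e)
    show ?case
    proof (cases "x = w")
      case True
      then show ?thesis using assms(1,2) by blast
    next
      case False
      with Suc.prems(1) obtain p \<mu> w' where w: "w = insert_at p \<mu> w'" "p \<le> length w'" "subseq x w'"
        by (rule subseq_insert_at)
      have len: "length w' = e" using Suc.hyps(2) w(1) by simp
      have D: "\<mu> \<in> D" "set w' \<subseteq> D"
        using Suc.prems(2) by (auto simp: w(1) set_insert_at)
      obtain F' where F': "F' \<in> vanishing r (ideal_gen G) e D" "leading F' w'"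
        using Suc.hyps(1)[of w'] len w(3) D(2) by auto
      note * = vanishing_insert_at[OF F' D(1), of p]
      have "mvar \<mu> * symmetrize F' \<in> ideal_gen (symmetrize ` vanishing r (ideal_gen G) e D)"
        using F'(1) by (intro ideal_gen_mult_gen) blast
      with * w len show ?thesis
        by (intro exI[of _ "lin (\<lambda>u. single (insert_at p \<mu> u) 1) F'"]) auto
    qed
  qed
  then show thesis using that by blast
qed

subsection \<open>Bounded generation\<close>

text \<open>Division with remainder: a leading word is cancelled by an element with the same leading word.\<close>

lemma symmetrize_in_ideal:
  fixes F :: "('v::linorder) word \<Rightarrow>\<^sub>0 'k::field"
  assumes D: "finite D" and lead: "\<And>F w. F \<in> vanishing r (ideal_gen G) e D \<Longrightarrow> leading F w \<Longrightarrow>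
      \<exists>F'\<in>vanishing r (ideal_gen G) e D. leading F' w \<and> symmetrize F' \<in> ideal_gen H"
    and "F \<in> vanishing r (ideal_gen G) e D"
  shows "symmetrize F \<in> ideal_gen H"
  using assms(3)
\<comment> \<open>The measure counts the words bounded by some word of the support. It drops when
  the leading word \<open>w\<close> is cancelled, since \<open>w\<close> itself is no longer
  counted.\<close>
proof (induction "card {u \<in> words e D. \<exists>w\<in>keys F. u \<le> w}" arbitrary: F rule: less_induct)
  case less
  show ?case
  proof (cases "F = 0")
    case True
    then show ?thesis by (simp add: symmetrize_def)
  next
    case False
    then obtain w where w: "leading F w" using leading_exists by blast
    then obtain F' where F': "F' \<in> vanishing r (ideal_gen G) e D" "leading F' w" "symmetrize F' \<in> ideal_gen H"
      using lead less.prems by blast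
    define R where "R = F - smul (lookup F w / lookup F' w) F'"
    have R: "R \<in> vanishing r (ideal_gen G) e D"
      unfolding R_def using less.prems F'(1) by (intro vanishing_diff vanishing_smul)
    have ne: "lookup F' w \<noteq> 0" using F'(2) by (simp add: leading_def in_keys_iff)
    have lt: "u < w" if "u \<in> keys R" for u
    proof -
      have "u \<noteq> w" using that ne by (auto simp: R_def in_keys_iff lookup_minus)
      moreover have "u \<in> keys F \<or> u \<in> keys F'"
        using that by (auto simp: R_def in_keys_iff lookup_minus)
      ultimately show ?thesis using w F'(2) by (auto simp: leading_def)
    qed
    have wF: "w \<in> keys F" "w \<in> words e D"
      using w less.prems by (auto simp: leading_def vanishing_def)
    have "{u \<in> words e D. \<exists>w\<in>keys R. u \<le> w} \<subset> {u \<in> words e D. \<exists>w\<in>keys F. u \<le> w}"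
    proof
      show "{u \<in> words e D. \<exists>w\<in>keys R. u \<le> w} \<subseteq> {u \<in> words e D. \<exists>w\<in>keys F. u \<le> w}"
        using lt wF(1) by (blast intro: order_trans less_imp_le)
      have "w \<notin> {u \<in> words e D. \<exists>w\<in>keys R. u \<le> w}"
        using lt by (auto simp: not_le)
      then show "{u \<in> words e D. \<exists>w\<in>keys R. u \<le> w} \<noteq> {u \<in> words e D. \<exists>w\<in>keys F. u \<le> w}"
        using wF by blast
    qed
    then have "symmetrize R \<in> ideal_gen H"
      using D by (intro less.hyps R psubset_card_mono) (simp_all add: finite_words)
    moreover have "symmetrize F = symmetrize R + smul (lookup F w / lookup F' w) (symmetrize F')"
      by (simp add: R_def symmetrize_def lin_diff lin_smul)
    ultimately show ?thesis
      using F'(3) by (auto intro: ideal_gen_add ideal_gen_smul)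
  qed
qed

section \<open>Reduction to bounded degree, uniformly in the multidegree\<close>

lemma mon_deg_sv_mons:
  assumes "\<mu> \<in> sv_mons m n d"
  shows "mon_deg \<mu> = (\<Sum>i<m. d i)"
proof -
  have "keys \<mu> \<subseteq> Sigma {..<m} (\<lambda>i. {..<n i})"
    using assms by (auto simp: sv_mons_def)
  then have "mon_deg \<mu> = (\<Sum>v\<in>Sigma {..<m} (\<lambda>i. {..<n i}). lookup \<mu> v)"
    by (intro mon_deg_superset) auto
  also have "\<dots> = (\<Sum>i<m. \<Sum>j<n i. lookup \<mu> (i, j))"
    by (simp add: sum.Sigma)
  finally show ?thesis using assms by (simp add: sv_mons_def)
qed

lemma finite_sv_mons: "finite (sv_mons m n d)"
proof -
  let ?S = "Sigma {..<m} (\<lambda>i. {..<n i})"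
  let ?\<delta> = "\<Sum>i<m. d i"
  have le: "lookup \<mu> v \<in> {..?\<delta>}" if "\<mu> \<in> sv_mons m n d" "v \<in> ?S" for \<mu> v
  proof -
    have "lookup \<mu> v \<le> (\<Sum>v\<in>keys \<mu>. lookup \<mu> v)"
      by (cases "v \<in> keys \<mu>") (auto intro: member_le_sum simp: in_keys_iff)
    then show ?thesis using mon_deg_sv_mons[OF that(1)] by (simp add: mon_deg_def)
  qed
  have zero: "lookup \<mu> v = 0" if "\<mu> \<in> sv_mons m n d" "v \<notin> ?S" for \<mu> v
    using that by (force simp: sv_mons_def in_keys_iff)
  have "lookup ` sv_mons m n d
      \<subseteq> {f. \<forall>v. (v \<in> ?S \<longrightarrow> f v \<in> {..?\<delta>}) \<and> (v \<notin> ?S \<longrightarrow> f v = 0)}"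
    by (intro image_subsetI CollectI allI conjI impI le zero)
  then have "finite (lookup ` sv_mons m n d)"
    by (rule finite_subset) (intro finite_set_of_finite_funs; simp)
  then show ?thesis
    by (rule finite_imageD) (rule inj_onI, rule poly_mapping_eqI, simp)
qed

text \<open>The two factors of a Higman embedding correspond to the two operations on lifts:
  letterwise comparison to multiplication by a word, passage from a subsequence to insertion of
  letters.\<close>

lemma list_emb_factor:
  assumes "list_emb P u w"
  obtains v where "list_all2 P u v" "subseq v w"
proof -
  have "\<exists>v. list_all2 P u v \<and> subseq v w"
    using assms by (induction rule: list_emb.induct) (auto intro: list_all2_Cons[THEN iffD2])
  then show thesis using that by blast
qed

text \<open>Every leading word \<open>w\<close> of length above \<open>C\<close> arises from a
  leading word \<open>u\<close> of length at most \<open>C\<close>, possibly for another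
  multidegree, by first multiplying and then inserting at least one letter.\<close>

lemma vanishing_reduction:
  fixes G :: "(nat \<times> nat \<times> nat, 'k::field) mpoly set"
  obtains C where "\<And>d e F w. C < e \<Longrightarrow> F \<in> vanishing r (ideal_gen G) e (sv_mons m n d) \<Longrightarrow> leading F w \<Longrightarrow>
      \<exists>F'\<in>vanishing r (ideal_gen G) e (sv_mons m n d). leading F' w \<and>
        symmetrize F' \<in> ideal_gen (symmetrize ` vanishing r (ideal_gen G) (e - 1) (sv_mons m n d))"
proof -
  let ?V = "\<lambda>e d. vanishing r (ideal_gen G) e (sv_mons m n d)"
  let ?le = "\<lambda>s t. \<forall>v. lookup s v \<le> lookup t v"
  let ?A = "{t :: nat \<times> nat \<Rightarrow>\<^sub>0 nat. keys t \<subseteq> Sigma {..<m} (\<lambda>i. {..<n i})}"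
  \<comment> \<open>Leading words for all multidegrees and all lengths are pooled, so that the bound
    \<open>C\<close> does not depend on \<open>d\<close>.\<close>
  define S where "S = {w. \<exists>d e. \<exists>F\<in>?V e d. leading F w}"
  have words: "w \<in> words e (sv_mons m n d)" if "F \<in> ?V e d" "leading F w" for F e d w
    using that by (auto simp: vanishing_def leading_def)
  have A: "sv_mons m n d \<subseteq> ?A" for d
    by (auto simp: sv_mons_def)
  have af: "almost_full_on ?le ?A"
    by (rule dickson) simp
  have refl: "?le t t" for t :: "nat \<times> nat \<Rightarrow>\<^sub>0 nat"
    by simp
  have "S \<subseteq> lists ?A"
    using words A by (fastforce simp: S_def words_def)
  from higman_bound[OF af refl this]
  obtain C where C: "\<And>w. w \<in> S \<Longrightarrow> \<exists>u\<in>S. length u \<le> C \<and> list_emb ?le u w"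
    by blast
  show thesis
  proof (rule that[of C])
    fix d e F w assume e: "C < e" and F: "F \<in> ?V e d" "leading F w"
    have w: "length w = e" "set w \<subseteq> sv_mons m n d"
      using words[OF F] by (auto simp: words_def)
    have "w \<in> S" using F by (auto simp: S_def)
    from C[OF this] obtain u where u: "u \<in> S" "length u \<le> C" "list_emb ?le u w" by blast
    obtain d0 e0 F0 where F0: "F0 \<in> ?V e0 d0" "leading F0 u"
      using u(1) by (auto simp: S_def)
    have u': "length u = e0" "set u \<subseteq> sv_mons m n d0"
      using words[OF F0] by (auto simp: words_def)
    obtain x where x: "list_all2 ?le u x" "subseq x w"
      using u(3) by (rule list_emb_factor)
    have x': "length x = e0" "set x \<subseteq> sv_mons m n d"
      using x u'(1) w(2) by (auto dest: list_all2_lengthD elim: list_emb_set)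
    \<comment> \<open>The letterwise quotient of \<open>x\<close> by \<open>u\<close>; by
      \<open>list_all2 ?le u x\<close> the subtraction of exponents is never truncated.\<close>
    define q where "q = map2 (-) x u"
    have qu: "q ! i + u ! i = x ! i" if "i < e0" for i
    proof (rule poly_mapping_eqI)
      fix v
      have "lookup (u ! i) v \<le> lookup (x ! i) v"
        using list_all2_nthD2[OF x(1), of i] that x'(1) by blast
      then show "lookup (q ! i + u ! i) v = lookup (x ! i) v"
        using that x'(1) u'(1) by (simp add: q_def lookup_add lookup_minus)
    qed
    have qx: "map2 (+) q u = x"
      using qu u'(1) x'(1) by (intro nth_equalityI) (auto simp: q_def)
    \<comment> \<open>Since \<open>q + u = x\<close> letterwise, each letter of \<open>q\<close> has
      multidegree \<open>d - d0\<close>, so adding it takes letters of multidegree \<open>d0\<close>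
      to letters of multidegree \<open>d\<close>.\<close>
    have "map2 (+) q y \<in> words e0 (sv_mons m n d)" if y: "y \<in> words e0 (sv_mons m n d0)" for y
    proof -
      have "q ! i + y ! i \<in> sv_mons m n d" if i: "i < e0" for i
      proof -
        have *: "y ! i \<in> sv_mons m n d0" "u ! i \<in> sv_mons m n d0" "x ! i \<in> sv_mons m n d"
          using i y u' x' by (auto simp: words_def)
        have "keys (q ! i) \<subseteq> keys (x ! i)"
          using qu[OF i, symmetric] by (auto simp: in_keys_iff lookup_add)
        then have "keys (q ! i + y ! i) \<subseteq> keys (x ! i) \<union> keys (y ! i)"
          using keys_add[of "q ! i" "y ! i"] by blast
        moreover have "(\<Sum>j<n k. lookup (q ! i + y ! i) (k, j)) = d k" if "k < m" for k
        proof -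
          have "(\<Sum>j<n k. lookup (q ! i) (k, j)) + d0 k = d k"
          proof -
            have "(\<Sum>j<n k. lookup (q ! i) (k, j) + lookup (u ! i) (k, j)) = d k"
              using * that by (simp add: sv_mons_def qu[OF i] flip: lookup_add)
            then show ?thesis using * that by (simp add: sv_mons_def sum.distrib)
          qed
          then show ?thesis
            using * that by (simp add: sv_mons_def lookup_add sum.distrib)
        qed
        ultimately show ?thesis using * by (auto simp: sv_mons_def)
      qed
      then show ?thesis
        using y x'(1) u'(1) by (auto simp: words_def q_def set_conv_nth)
    qed
    then have F1: "lin (\<lambda>u. single (map2 (+) q u) 1) F0 \<in> ?V (length x) d"
        "leading (lin (\<lambda>u. single (map2 (+) q u) 1) F0) x"
      using vanishing_mult_word[OF F0, of q "sv_mons m n d"] u'(1) x'(1) qx by (simp_all add: q_def)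
    \<comment> \<open>As \<open>x\<close> has the length of \<open>u\<close>, which is at most
      \<open>C < e\<close>, a genuine insertion takes place.\<close>
    have "length x < length w" using e u(2) u'(1) x'(1) w(1) by simp
    with vanishing_subseq[OF F1 x(2) w(2)] w(1)
    show "\<exists>F'\<in>?V e d. leading F' w \<and> symmetrize F' \<in> ideal_gen (symmetrize ` ?V (e - 1) d)"
      by metis
  qed
qed

theorem theorem6p3:
  fixes m :: nat and n :: "nat \<Rightarrow> nat" and I :: "nat \<Rightarrow> (nat, 'k::field_char_0) mpoly set"
  assumes "m \<ge> 1"
    and "\<And>i. i < m \<Longrightarrow> homogeneous_ideal {..<n i} (I i)"
  shows "\<forall>r\<ge>1. \<exists>C::nat. \<forall>d::nat \<Rightarrow> nat. (\<forall>i<m. d i \<ge> 1) \<longrightarrow>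
           generated_in_degree_le (sv_mons m n d) (sec_ideal m n I d r) C"
proof (intro allI impI)
  fix r :: nat assume r: "r \<ge> 1"
  obtain G where G: "power_ideal r (prod_ideal m n I) = ideal_gen G"
    by (simp add: power_ideal_def)
  let ?V = "\<lambda>e d. vanishing r (ideal_gen G) e (sv_mons m n d)"
  obtain C where C: "\<And>d e F w. C < e \<Longrightarrow> F \<in> ?V e d \<Longrightarrow> leading F w \<Longrightarrow>
      \<exists>F'\<in>?V e d. leading F' w \<and> symmetrize F' \<in> ideal_gen (symmetrize ` ?V (e - 1) d)"
    by (rule vanishing_reduction[of r G m n]) blast
  have "generated_in_degree_le (sv_mons m n d) (sec_ideal m n I d r) C" if d: "\<forall>i<m. d i \<ge> 1" for d
  proof -
    let ?D = "sv_mons m n d"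
    have sec: "f \<in> sec_ideal m n I d r
        \<longleftrightarrow> f \<in> poly_in ?D \<and> poly_subst (sum_copies r) f \<in> ideal_gen G" for f
      using sec_ideal_eq[OF r, of m n I d] by (simp add: G)
    define H where "H = {g \<in> sec_ideal m n I d r. total_deg g \<le> C}"
    \<comment> \<open>Strong induction on \<open>e\<close>: up to \<open>C\<close> the
      symmetrization belongs to \<open>H\<close> itself, and above \<open>C\<close> it is generated
      by symmetrizations from length \<open>e - 1\<close>.\<close>
    have V: "symmetrize F \<in> ideal_gen H" if "F \<in> ?V e d" for e F
      using that
    proof (induction e arbitrary: F rule: less_induct)
      case (less e)
      show ?case
      proof (cases "e \<le> C")
        case True
        then show ?thesis
          using symmetrize_vanishing[OF less.prems] by (intro ideal_gen_base) (auto simp: H_def sec)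
      next
        case False
        have "symmetrize F \<in> ideal_gen (symmetrize ` ?V (e - 1) d)"
          using False C[of e] less.prems
          by (intro symmetrize_in_ideal[OF finite_sv_mons]) auto
        moreover have "symmetrize ` ?V (e - 1) d \<subseteq> ideal_gen H"
          using False less.IH[of "e - 1"] by auto
        ultimately show ?thesis using ideal_gen_subset by blast
      qed
    qed
    have "sec_ideal m n I d r \<subseteq> ideal_gen H"
    proof
      fix f assume f: "f \<in> sec_ideal m n I d r"
      \<comment> \<open>The letters must have positive total degree for a multidegree to determine
        its colouring up to permutation; this uses \<open>m \<ge> 1\<close> and the positivity of
        \<open>d\<close>.\<close>
      have "d 0 \<ge> 1" "d 0 \<le> (\<Sum>i<m. d i)"
        using assms(1) d by (auto intro: member_le_sum)
      then have \<delta>: "(\<Sum>i<m. d i) \<ge> 1" by linarith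
      have F: "restrict_to (\<lambda>w. length w = e) (sym_lift f) \<in> ?V e d" for e
        using f restrict_to_power_ideal[of m n I _ r, OF assms(2)] mon_deg_sv_mons
        by (intro sym_lift_vanishing[OF _ _ \<delta>]) (auto simp: sec G)
      \<comment> \<open>The polynomial \<open>f\<close> need not be homogeneous, so its lift is
        split by word length, that is, by degree in the coordinates.\<close>
      let ?E = "length ` keys (sym_lift f)"
      have "sym_lift f = (\<Sum>e\<in>?E. restrict_to (\<lambda>w. length w = e) (sym_lift f))"
        by (rule poly_mapping_eqI) (auto simp: lookup_sum lookup_restrict_to in_keys_iff)
      then have "symmetrize (sym_lift f)
          = (\<Sum>e\<in>?E. symmetrize (restrict_to (\<lambda>w. length w = e) (sym_lift f)))"
        by (metis lin_sum symmetrize_def)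
      also have "\<dots> \<in> ideal_gen H"
        by (intro ideal_gen_sum V[OF F])
      finally show "f \<in> ideal_gen H" by (simp add: symmetrize_sym_lift)
    qed
    moreover have "f \<in> sec_ideal m n I d r" if "f \<in> poly_in ?D" "f \<in> ideal_gen H" for f
      using that(1) poly_subst_ideal_gen[OF that(2), of "sum_copies r" G] by (auto simp: sec H_def)
    ultimately have "sec_ideal m n I d r = poly_in ?D \<inter> ideal_gen H"
      using sec by blast
    moreover have "H \<subseteq> poly_in ?D" "\<forall>g\<in>H. total_deg g \<le> C"
      by (auto simp: H_def sec)
    ultimately show ?thesis
      unfolding generated_in_degree_le_def by (intro exI[of _ H] conjI)
  qed
  then show "\<exists>C. \<forall>d. (\<forall>i<m. d i \<ge> 1) \<longrightarrow>
      generated_in_degree_le (sv_mons m n d) (sec_ideal m n I d r) C"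
    by blast
qed

end
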